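(* Let $\mathcal T,\mathcal F,\mathcal D$ be three full subcategories of an abelian category $\mathcal A$ such that $(\mathcal T,\mathcal F)$ is a torsion pair and $(\mathcal F,\mathcal D)$ is a cotorsion pair. Then there is an equivalence of categories $$\mathcal T\simeq\frac{\mathcal D}{\mathcal F\cap\mathcal D}.$$
   Context: Subcategories are full and closed under isomorphism. A torsion pair in an abelian category $\mathcal A$ is a pair $(\mathcal T,\mathcal F)$ of full subcategories such that (1) $\operatorname{Hom}_{\mathcal A}(T,F)=0$ for all $T\in\mathcal T,F\in\mathcal F$, and (2) for every $A\in\mathcal A$ there is a short exact sequence $0\to\mathsf tA\to A\to\mathsf fA\to0$ with $\mathsf tA\in\mathcal T$, $\mathsf fA\in\mathcal F$. For $\mathcal X\subseteq\mathcal A$ put $\mathcal X^{\perp_1}=\{A\mid\operatorname{Ext}^1_{\mathcal A}(X,A)=0\ \forall X\in\mathcal X\}$ and ${}^{\perp_1}\mathcal X=\{A\mid\operatorname{Ext}^1_{\mathcal A}(A,X)=0\ \forall X\in\mathcal X\}$. A cotorsion pair is a pair $(\mathcal C,\mathcal D)$ of full subcategories such that (1) $\mathcal C={}^{\perp_1}\mathcal D$ and $\mathcal D=\mathcal C^{\perp_1}$, and (2) for every $A\in\mathcal A$ there are short exact sequences $0\to D\to C\to A\to0$ and $0\to A\to D'\to C'\to0$ with $C,C'\in\mathcal C$ and $D,D'\in\mathcal D$. For an additive category $\mathcal E$ and a full subcategory $\mathcal X$ closed under finite direct sums, $\mathcal E/\mathcal X$ is the category with the same objects as $\mathcal E$ and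 $\operatorname{Hom}_{\mathcal E/\mathcal X}(E,E')=\operatorname{Hom}_{\mathcal E}(E,E')/\sim$, where $f\sim g$ iff $f-g$ factors through an object of $\mathcal X$. *)

theory Defs
  imports "HOL-Algebra.Group"
begin

section \<open>Categories, functors, equivalences\<close>

text \<open>A category is given by a set of objects and a set of arrows with domain and codomain maps,
  so distinct Hom-sets are disjoint. The object and arrow types are arbitrary, hence no smallness
  is imposed. Composition is written in the order of functions, \<open>g \<cdot> f\<close> meaning \<open>f\<close> first.\<close>

record ('o, 'm) cat_data =
  Ob :: "'o set"
  Arr :: "'m set"
  Dom :: "'m \<Rightarrow> 'o"
  Cod :: "'m \<Rightarrow> 'o"
  Ident :: "'o \<Rightarrow> 'm"
  Comp :: "'m \<Rightarrow> 'm \<Rightarrow> 'm" (infixr "\<cdot>\<index>" 70)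

definition Hom :: "('o, 'm, 'x) cat_data_scheme \<Rightarrow> 'o \<Rightarrow> 'o \<Rightarrow> 'm set" where
  "Hom C A B = {f \<in> Arr C. Dom C f = A \<and> Cod C f = B}"

locale category =
  fixes C :: "('o, 'm, 'x) cat_data_scheme" (structure)
  assumes Dom_in_Ob: "f \<in> Arr C \<Longrightarrow> Dom C f \<in> Ob C"
    and Cod_in_Ob: "f \<in> Arr C \<Longrightarrow> Cod C f \<in> Ob C"
    and Ident_in_Hom: "A \<in> Ob C \<Longrightarrow> Ident C A \<in> Hom C A A"
    and Comp_in_Hom: "f \<in> Hom C A B \<Longrightarrow> g \<in> Hom C B D \<Longrightarrow> g \<cdot> f \<in> Hom C A D"
    and Comp_Ident_right: "f \<in> Hom C A B \<Longrightarrow> f \<cdot> Ident C A = f"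
    and Comp_Ident_left: "f \<in> Hom C A B \<Longrightarrow> Ident C B \<cdot> f = f"
    and Comp_assoc: "f \<in> Hom C A B \<Longrightarrow> g \<in> Hom C B D \<Longrightarrow> h \<in> Hom C D E
      \<Longrightarrow> (h \<cdot> g) \<cdot> f = h \<cdot> (g \<cdot> f)"

definition is_iso :: "('o, 'm, 'x) cat_data_scheme \<Rightarrow> 'm \<Rightarrow> bool" where
  "is_iso C f \<longleftrightarrow> f \<in> Arr C \<and>
     (\<exists>g \<in> Hom C (Cod C f) (Dom C f).
        g \<cdot>\<^bsub>C\<^esub> f = Ident C (Dom C f) \<and> f \<cdot>\<^bsub>C\<^esub> g = Ident C (Cod C f))"

definition is_mono :: "('o, 'm, 'x) cat_data_scheme \<Rightarrow> 'm \<Rightarrow> bool" where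
  "is_mono C f \<longleftrightarrow> f \<in> Arr C \<and>
     (\<forall>A \<in> Ob C. \<forall>g \<in> Hom C A (Dom C f). \<forall>h \<in> Hom C A (Dom C f).
        f \<cdot>\<^bsub>C\<^esub> g = f \<cdot>\<^bsub>C\<^esub> h \<longrightarrow> g = h)"

definition is_epi :: "('o, 'm, 'x) cat_data_scheme \<Rightarrow> 'm \<Rightarrow> bool" where
  "is_epi C f \<longleftrightarrow> f \<in> Arr C \<and>
     (\<forall>A \<in> Ob C. \<forall>g \<in> Hom C (Cod C f) A. \<forall>h \<in> Hom C (Cod C f) A.
        g \<cdot>\<^bsub>C\<^esub> f = h \<cdot>\<^bsub>C\<^esub> f \<longrightarrow> g = h)"

locale category_functor = dom: category C + cod: category D
  for C :: "('o, 'm, 'x) cat_data_scheme" and D :: "('p, 'n, 'y) cat_data_scheme" +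
  fixes FO :: "'o \<Rightarrow> 'p" and FA :: "'m \<Rightarrow> 'n"
  assumes maps_Ob: "A \<in> Ob C \<Longrightarrow> FO A \<in> Ob D"
    and maps_Hom: "f \<in> Hom C A B \<Longrightarrow> FA f \<in> Hom D (FO A) (FO B)"
    and maps_Ident: "A \<in> Ob C \<Longrightarrow> FA (Ident C A) = Ident D (FO A)"
    and maps_Comp: "f \<in> Hom C A B \<Longrightarrow> g \<in> Hom C B E
      \<Longrightarrow> FA (g \<cdot>\<^bsub>C\<^esub> f) = FA g \<cdot>\<^bsub>D\<^esub> FA f"

definition natural_iso ::
  "('o, 'm, 'x) cat_data_scheme \<Rightarrow> ('p, 'n, 'y) cat_data_scheme \<Rightarrow>
   ('o \<Rightarrow> 'p) \<Rightarrow> ('m \<Rightarrow> 'n) \<Rightarrow> ('o \<Rightarrow> 'p) \<Rightarrow> ('m \<Rightarrow> 'n) \<Rightarrow> ('o \<Rightarrow> 'n) \<Rightarrow> bool" where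
  "natural_iso C D FO FA GO GA \<eta> \<longleftrightarrow>
     (\<forall>A \<in> Ob C. \<eta> A \<in> Hom D (FO A) (GO A) \<and> is_iso D (\<eta> A)) \<and>
     (\<forall>f \<in> Arr C. \<eta> (Cod C f) \<cdot>\<^bsub>D\<^esub> FA f = GA f \<cdot>\<^bsub>D\<^esub> \<eta> (Dom C f))"

definition equivalent_categories ::
  "('o, 'm, 'x) cat_data_scheme \<Rightarrow> ('p, 'n, 'y) cat_data_scheme \<Rightarrow> bool" where
  "equivalent_categories C D \<longleftrightarrow>
     (\<exists>FO FA GO GA \<eta> \<epsilon>.
        category_functor C D FO FA \<and> category_functor D C GO GA \<and>
        natural_iso C C id id (GO \<circ> FO) (GA \<circ> FA) \<eta> \<and>
        natural_iso D D (FO \<circ> GO) (FA \<circ> GA) id id \<epsilon>)"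

definition is_full_subcategory :: "('o, 'm, 'x) cat_data_scheme \<Rightarrow> 'o set \<Rightarrow> bool" where
  "is_full_subcategory C X \<longleftrightarrow> X \<subseteq> Ob C \<and>
     (\<forall>f. is_iso C f \<and> Dom C f \<in> X \<longrightarrow> Cod C f \<in> X)"

definition full_subcategory ::
  "('o, 'm, 'x) cat_data_scheme \<Rightarrow> 'o set \<Rightarrow> ('o, 'm, 'x) cat_data_scheme" where
  "full_subcategory C X =
     C\<lparr>Ob := X, Arr := {f \<in> Arr C. Dom C f \<in> X \<and> Cod C f \<in> X}\<rparr>"


section \<open>Abelian categories\<close>

record ('o, 'm) preadditive_data = "('o, 'm) cat_data" +
  Add :: "'m \<Rightarrow> 'm \<Rightarrow> 'm"
  Zero :: "'o \<Rightarrow> 'o \<Rightarrow> 'm"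

definition hom_group :: "('o, 'm, 'x) preadditive_data_scheme \<Rightarrow> 'o \<Rightarrow> 'o \<Rightarrow> 'm monoid" where
  "hom_group C A B = \<lparr>carrier = Hom C A B, mult = Add C, one = Zero C A B\<rparr>"

definition Diff :: "('o, 'm, 'x) preadditive_data_scheme \<Rightarrow> 'm \<Rightarrow> 'm \<Rightarrow> 'm" where
  "Diff C f g = Add C f (inv\<^bsub>hom_group C (Dom C g) (Cod C g)\<^esub> g)"

locale preadditive_category = category C
  for C :: "('o, 'm, 'x) preadditive_data_scheme" (structure) +
  assumes hom_comm_group: "A \<in> Ob C \<Longrightarrow> B \<in> Ob C \<Longrightarrow> comm_group (hom_group C A B)"
    and Comp_Add_right: "f \<in> Hom C A B \<Longrightarrow> f' \<in> Hom C A B \<Longrightarrow> g \<in> Hom C B D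
      \<Longrightarrow> g \<cdot> Add C f f' = Add C (g \<cdot> f) (g \<cdot> f')"
    and Comp_Add_left: "f \<in> Hom C A B \<Longrightarrow> g \<in> Hom C B D \<Longrightarrow> g' \<in> Hom C B D
      \<Longrightarrow> Add C g g' \<cdot> f = Add C (g \<cdot> f) (g' \<cdot> f)"

definition is_zero_object :: "('o, 'm, 'x) cat_data_scheme \<Rightarrow> 'o \<Rightarrow> bool" where
  "is_zero_object C Z \<longleftrightarrow> Z \<in> Ob C \<and>
     (\<forall>A \<in> Ob C. (\<exists>!f. f \<in> Hom C A Z) \<and> (\<exists>!f. f \<in> Hom C Z A))"

definition is_biproduct ::
  "('o, 'm, 'x) preadditive_data_scheme \<Rightarrow> 'o \<Rightarrow> 'o \<Rightarrow> 'o \<Rightarrow> 'm \<Rightarrow> 'm \<Rightarrow> 'm \<Rightarrow> 'm \<Rightarrow> bool" where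
  "is_biproduct C A B P i\<^sub>A i\<^sub>B p\<^sub>A p\<^sub>B \<longleftrightarrow>
     A \<in> Ob C \<and> B \<in> Ob C \<and> P \<in> Ob C \<and>
     i\<^sub>A \<in> Hom C A P \<and> i\<^sub>B \<in> Hom C B P \<and> p\<^sub>A \<in> Hom C P A \<and> p\<^sub>B \<in> Hom C P B \<and>
     p\<^sub>A \<cdot>\<^bsub>C\<^esub> i\<^sub>A = Ident C A \<and> p\<^sub>B \<cdot>\<^bsub>C\<^esub> i\<^sub>B = Ident C B \<and>
     p\<^sub>B \<cdot>\<^bsub>C\<^esub> i\<^sub>A = Zero C A B \<and> p\<^sub>A \<cdot>\<^bsub>C\<^esub> i\<^sub>B = Zero C B A \<and>
     Add C (i\<^sub>A \<cdot>\<^bsub>C\<^esub> p\<^sub>A) (i\<^sub>B \<cdot>\<^bsub>C\<^esub> p\<^sub>B) = Ident C P"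

locale additive_category = preadditive_category +
  assumes ex_zero_object: "\<exists>Z. is_zero_object C Z"
    and ex_biproduct: "A \<in> Ob C \<Longrightarrow> B \<in> Ob C
      \<Longrightarrow> \<exists>P i\<^sub>A i\<^sub>B p\<^sub>A p\<^sub>B. is_biproduct C A B P i\<^sub>A i\<^sub>B p\<^sub>A p\<^sub>B"

definition is_kernel :: "('o, 'm, 'x) preadditive_data_scheme \<Rightarrow> 'm \<Rightarrow> 'm \<Rightarrow> bool" where
  "is_kernel C f k \<longleftrightarrow> f \<in> Arr C \<and> k \<in> Arr C \<and> Cod C k = Dom C f \<and>
     f \<cdot>\<^bsub>C\<^esub> k = Zero C (Dom C k) (Cod C f) \<and>
     (\<forall>A \<in> Ob C. \<forall>g \<in> Hom C A (Dom C f). f \<cdot>\<^bsub>C\<^esub> g = Zero C A (Cod C f) \<longrightarrow>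
        (\<exists>!u. u \<in> Hom C A (Dom C k) \<and> k \<cdot>\<^bsub>C\<^esub> u = g))"

definition is_cokernel :: "('o, 'm, 'x) preadditive_data_scheme \<Rightarrow> 'm \<Rightarrow> 'm \<Rightarrow> bool" where
  "is_cokernel C f c \<longleftrightarrow> f \<in> Arr C \<and> c \<in> Arr C \<and> Dom C c = Cod C f \<and>
     c \<cdot>\<^bsub>C\<^esub> f = Zero C (Dom C f) (Cod C c) \<and>
     (\<forall>A \<in> Ob C. \<forall>g \<in> Hom C (Cod C f) A. g \<cdot>\<^bsub>C\<^esub> f = Zero C (Dom C f) A \<longrightarrow>
        (\<exists>!u. u \<in> Hom C (Cod C c) A \<and> u \<cdot>\<^bsub>C\<^esub> c = g))"

locale abelian_category = additive_category +
  assumes ex_kernel: "f \<in> Arr C \<Longrightarrow> \<exists>k. is_kernel C f k"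
    and ex_cokernel: "f \<in> Arr C \<Longrightarrow> \<exists>c. is_cokernel C f c"
    and mono_is_kernel: "is_mono C f \<Longrightarrow> \<exists>g. is_kernel C g f"
    and epi_is_cokernel: "is_epi C f \<Longrightarrow> \<exists>g. is_cokernel C g f"

definition is_image :: "('o, 'm, 'x) preadditive_data_scheme \<Rightarrow> 'm \<Rightarrow> 'm \<Rightarrow> bool" where
  "is_image C f m \<longleftrightarrow> (\<exists>c. is_cokernel C f c \<and> is_kernel C c m)"

definition short_exact ::
  "('o, 'm, 'x) preadditive_data_scheme \<Rightarrow> 'o \<Rightarrow> 'o \<Rightarrow> 'o \<Rightarrow> 'm \<Rightarrow> 'm \<Rightarrow> bool" where
  "short_exact C A E B i p \<longleftrightarrow> i \<in> Hom C A E \<and> p \<in> Hom C E B \<and>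
     is_mono C i \<and> is_epi C p \<and> (\<exists>m. is_image C i m \<and> is_kernel C p m)"


section \<open>The first Ext group\<close>

text \<open>Yoneda's description: the elements of $\mathrm{Ext}^1(X, A)$ are the equivalence classes of
  short exact sequences $0 \to A \to E \to X \to 0$, and its zero element is the class of
  $0 \to A \to A \oplus X \to X \to 0$. The Baer sum is not needed to say that the group is zero.\<close>

definition extensions ::
  "('o, 'm, 'x) preadditive_data_scheme \<Rightarrow> 'o \<Rightarrow> 'o \<Rightarrow> ('o \<times> 'm \<times> 'm) set" where
  "extensions C X A = {(E, i, p). short_exact C A E X i p}"

definition extension_rel ::
  "('o, 'm, 'x) preadditive_data_scheme \<Rightarrow> 'o \<Rightarrow> 'o \<Rightarrow> ('o \<times> 'm \<times> 'm) rel" where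
  "extension_rel C X A =
     {((E, i, p), (E', i', p')).
        (E, i, p) \<in> extensions C X A \<and> (E', i', p') \<in> extensions C X A \<and>
        (\<exists>\<phi> \<in> Hom C E E'. is_iso C \<phi> \<and> \<phi> \<cdot>\<^bsub>C\<^esub> i = i' \<and> p' \<cdot>\<^bsub>C\<^esub> \<phi> = p)}"

definition Ext1 ::
  "('o, 'm, 'x) preadditive_data_scheme \<Rightarrow> 'o \<Rightarrow> 'o \<Rightarrow> ('o \<times> 'm \<times> 'm) set set" where
  "Ext1 C X A = extensions C X A // extension_rel C X A"

definition Ext1_zero ::
  "('o, 'm, 'x) preadditive_data_scheme \<Rightarrow> 'o \<Rightarrow> 'o \<Rightarrow> ('o \<times> 'm \<times> 'm) set" where
  "Ext1_zero C X A =
     extension_rel C X A ``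
       {(P, i\<^sub>A, p\<^sub>X) | P i\<^sub>A p\<^sub>X. \<exists>i\<^sub>X p\<^sub>A. is_biproduct C A X P i\<^sub>A i\<^sub>X p\<^sub>A p\<^sub>X}"

definition Ext1_vanishes :: "('o, 'm, 'x) preadditive_data_scheme \<Rightarrow> 'o \<Rightarrow> 'o \<Rightarrow> bool" where
  "Ext1_vanishes C X A \<longleftrightarrow> Ext1 C X A = {Ext1_zero C X A}"

definition right_perp1 :: "('o, 'm, 'x) preadditive_data_scheme \<Rightarrow> 'o set \<Rightarrow> 'o set" where
  "right_perp1 C \<X> = {A \<in> Ob C. \<forall>X \<in> \<X>. Ext1_vanishes C X A}"

definition left_perp1 :: "('o, 'm, 'x) preadditive_data_scheme \<Rightarrow> 'o set \<Rightarrow> 'o set" where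
  "left_perp1 C \<X> = {A \<in> Ob C. \<forall>X \<in> \<X>. Ext1_vanishes C A X}"


section \<open>Torsion pairs, cotorsion pairs, additive quotients\<close>

definition torsion_pair :: "('o, 'm, 'x) preadditive_data_scheme \<Rightarrow> 'o set \<Rightarrow> 'o set \<Rightarrow> bool" where
  "torsion_pair C \<T> \<F> \<longleftrightarrow>
     is_full_subcategory C \<T> \<and> is_full_subcategory C \<F> \<and>
     (\<forall>T \<in> \<T>. \<forall>F \<in> \<F>. Hom C T F = {Zero C T F}) \<and>
     (\<forall>A \<in> Ob C. \<exists>tA \<in> \<T>. \<exists>fA \<in> \<F>. \<exists>i p. short_exact C tA A fA i p)"

definition cotorsion_pair :: "('o, 'm, 'x) preadditive_data_scheme \<Rightarrow> 'o set \<Rightarrow> 'o set \<Rightarrow> bool" where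
  "cotorsion_pair A \<C> \<D> \<longleftrightarrow>
     is_full_subcategory A \<C> \<and> is_full_subcategory A \<D> \<and>
     \<C> = left_perp1 A \<D> \<and> \<D> = right_perp1 A \<C> \<and>
     (\<forall>X \<in> Ob A.
        (\<exists>C \<in> \<C>. \<exists>D \<in> \<D>. \<exists>i p. short_exact A D C X i p) \<and>
        (\<exists>C' \<in> \<C>. \<exists>D' \<in> \<D>. \<exists>i p. short_exact A X D' C' i p))"

definition factors_through :: "('o, 'm, 'x) cat_data_scheme \<Rightarrow> 'o set \<Rightarrow> 'm \<Rightarrow> bool" where
  "factors_through E \<X> f \<longleftrightarrow>
     (\<exists>X \<in> \<X>. \<exists>u \<in> Hom E (Dom E f) X. \<exists>v \<in> Hom E X (Cod E f). f = v \<cdot>\<^bsub>E\<^esub> u)"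

definition factor_rel :: "('o, 'm, 'x) preadditive_data_scheme \<Rightarrow> 'o set \<Rightarrow> 'm rel" where
  "factor_rel E \<X> =
     {(f, g). f \<in> Arr E \<and> g \<in> Hom E (Dom E f) (Cod E f) \<and> factors_through E \<X> (Diff E f g)}"

text \<open>Arrows of the quotient are classes of parallel arrows, so the images of a class under
  \<open>Dom\<close> and \<open>Cod\<close> are singletons, and the set defining the composite of two classes is a
  single class whenever \<open>\<X>\<close> is closed under finite direct sums.\<close>

definition quotient_category ::
  "('o, 'm, 'x) preadditive_data_scheme \<Rightarrow> 'o set \<Rightarrow> ('o, 'm set) cat_data" where
  "quotient_category E \<X> =
     \<lparr>Ob = Ob E,
      Arr = Arr E // factor_rel E \<X>,
      Dom = (\<lambda>K. the_elem (Dom E ` K)),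
      Cod = (\<lambda>K. the_elem (Cod E ` K)),
      Ident = (\<lambda>A. factor_rel E \<X> `` {Ident E A}),
      Comp = (\<lambda>K L. factor_rel E \<X> `` {g \<cdot>\<^bsub>E\<^esub> f | g f. g \<in> K \<and> f \<in> L})\<rparr>"

end

theory Submission
  imports Defs
begin

text \<open>Embed each \<open>T \<in> \<T>\<close> into some \<open>V T \<in> \<D>\<close> by \<open>j T\<close> with cokernel in \<open>\<F>\<close>; then \<open>j T\<close> is also
  the torsion part of \<open>V T\<close>. For \<open>X, Y \<in> \<D>\<close> and the torsion part \<open>i : T \<rightarrow> X\<close>, vanishing of
  $\mathrm{Ext}^1(\mathcal F, \mathcal D)$ extends every arrow \<open>T \<rightarrow> Y\<close> along \<open>i\<close>, and
  an arrow \<open>X \<rightarrow> Y\<close> factors through \<open>\<F> \<inter> \<D>\<close> iff it vanishes on \<open>i\<close>: if it does, it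
  factors through \<open>X/T \<in> \<F>\<close>, hence through a special \<open>\<D>\<close>-preenvelope of \<open>X/T\<close>, which lies in \<open>\<F>\<close>
  because \<open>\<F>\<close> is closed under extensions. So an arrow \<open>f : S \<rightarrow> T\<close> of \<open>\<T>\<close> corresponds to the
  class of all \<open>g : V S \<rightarrow> V T\<close> with \<open>g \<cdot> j S = j T \<cdot> f\<close>, which gives a fully faithful
  functor; it is essentially surjective since two objects of \<open>\<D>\<close> with the same torsion part are
  isomorphic in the quotient.\<close>

section \<open>Categories\<close>

lemma HomD:
  assumes "f \<in> Hom C A B"
  shows "f \<in> Arr C" "Dom C f = A" "Cod C f = B"
  using assms by (auto simp: Hom_def)

lemma Arr_in_Hom: "f \<in> Arr C \<Longrightarrow> f \<in> Hom C (Dom C f) (Cod C f)"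
  by (simp add: Hom_def)

lemma is_isoI:
  assumes "f \<in> Hom C A B" "g \<in> Hom C B A"
    and "g \<cdot>\<^bsub>C\<^esub> f = Ident C A" "f \<cdot>\<^bsub>C\<^esub> g = Ident C B"
  shows "is_iso C f"
  using assms unfolding is_iso_def by (auto simp: Hom_def)

lemma is_isoE:
  assumes "is_iso C f" "f \<in> Hom C A B"
  obtains g where "g \<in> Hom C B A" "g \<cdot>\<^bsub>C\<^esub> f = Ident C A" "f \<cdot>\<^bsub>C\<^esub> g = Ident C B"
  using assms unfolding is_iso_def by (auto simp: Hom_def)

context category
begin

lemma Hom_Ob: "f \<in> Hom C A B \<Longrightarrow> A \<in> Ob C" "f \<in> Hom C A B \<Longrightarrow> B \<in> Ob C"
  using Dom_in_Ob Cod_in_Ob by (auto simp: Hom_def)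

lemma is_iso_Ident: "A \<in> Ob C \<Longrightarrow> is_iso C (Ident C A)"
  using Ident_in_Hom Comp_Ident_left is_isoI by metis

lemma is_monoD:
  assumes "is_mono C m" "m \<in> Hom C A B" "g \<in> Hom C W A" "h \<in> Hom C W A" "m \<cdot> g = m \<cdot> h"
  shows "g = h"
  using assms Hom_Ob(1)[OF assms(3)] HomD[OF assms(2)] unfolding is_mono_def by blast

lemma is_epiD:
  assumes "is_epi C e" "e \<in> Hom C A B" "g \<in> Hom C B W" "h \<in> Hom C B W" "g \<cdot> e = h \<cdot> e"
  shows "g = h"
  using assms Hom_Ob(2)[OF assms(3)] HomD[OF assms(2)] unfolding is_epi_def by blast

lemma Hom_full_subcategory:
  "A \<in> X \<Longrightarrow> B \<in> X \<Longrightarrow> Hom (full_subcategory C X) A B = Hom C A B"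
  by (auto simp: Hom_def full_subcategory_def)

lemma Hom_full_subcategoryD:
  "f \<in> Hom (full_subcategory C X) A B \<Longrightarrow> f \<in> Hom C A B \<and> A \<in> X \<and> B \<in> X"
  by (auto simp: Hom_def full_subcategory_def)

lemma full_subcategory_simps [simp]:
  "Ob (full_subcategory C X) = X"
  "Dom (full_subcategory C X) = Dom C"
  "Cod (full_subcategory C X) = Cod C"
  "Ident (full_subcategory C X) = Ident C"
  "Comp (full_subcategory C X) = Comp C"
  by (simp_all add: full_subcategory_def)

lemma category_full_subcategory:
  assumes "X \<subseteq> Ob C"
  shows "category (full_subcategory C X)"
proof
  show "Dom (full_subcategory C X) f \<in> Ob (full_subcategory C X)"
    "Cod (full_subcategory C X) f \<in> Ob (full_subcategory C X)"
    if "f \<in> Arr (full_subcategory C X)" for f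
    using that by (auto simp: full_subcategory_def)
  show "Ident (full_subcategory C X) A \<in> Hom (full_subcategory C X) A A"
    if "A \<in> Ob (full_subcategory C X)" for A
    using that assms Ident_in_Hom by (auto simp: Hom_full_subcategory)
qed (use Comp_in_Hom Comp_Ident_right Comp_Ident_left Comp_assoc in
    \<open>auto dest!: Hom_full_subcategoryD simp: Hom_full_subcategory\<close>)

end

text \<open>Choose for each \<open>B\<close> an object \<open>GO B\<close> and an isomorphism
  \<open>e B\<close> with inverse \<open>e' B\<close>. The arrows needed in the first category are
  preimages under \<open>FA\<close>, and equations between them are verified in the second category
  by faithfulness.\<close>

lemma equivalent_categories_if_fully_faithful:
  assumes "category_functor C D FO FA"
    and ff: "\<And>A B. A \<in> Ob C \<Longrightarrow> B \<in> Ob C \<Longrightarrow> bij_betw FA (Hom C A B) (Hom D (FO A) (FO B))"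
    and es: "\<And>B. B \<in> Ob D \<Longrightarrow> \<exists>A \<in> Ob C. \<exists>e \<in> Hom D (FO A) B. is_iso D e"
  shows "equivalent_categories C D"
proof -
  interpret F: category_functor C D FO FA by fact
  have "\<exists>A e e'. A \<in> Ob C \<and> e \<in> Hom D (FO A) B \<and> e' \<in> Hom D B (FO A)
      \<and> e' \<cdot>\<^bsub>D\<^esub> e = Ident D (FO A) \<and> e \<cdot>\<^bsub>D\<^esub> e' = Ident D B" if "B \<in> Ob D" for B
    using es[OF that] by (metis is_isoE)
  then obtain GO e e' where GO: "\<And>B. B \<in> Ob D \<Longrightarrow> GO B \<in> Ob C"
    and e: "\<And>B. B \<in> Ob D \<Longrightarrow> e B \<in> Hom D (FO (GO B)) B"
    and e': "\<And>B. B \<in> Ob D \<Longrightarrow> e' B \<in> Hom D B (FO (GO B))"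
    and e'e: "\<And>B. B \<in> Ob D \<Longrightarrow> e' B \<cdot>\<^bsub>D\<^esub> e B = Ident D (FO (GO B))"
    and ee': "\<And>B. B \<in> Ob D \<Longrightarrow> e B \<cdot>\<^bsub>D\<^esub> e' B = Ident D B"
    by metis
  define pre where "pre A B = inv_into (Hom C A B) FA" for A B
  have pre: "pre A B h \<in> Hom C A B" "FA (pre A B h) = h"
    if "A \<in> Ob C" "B \<in> Ob C" "h \<in> Hom D (FO A) (FO B)" for A B h
    using ff[OF that(1,2)] that(3) unfolding pre_def
    by (auto simp: bij_betw_def inv_into_into f_inv_into_f)
  have faithful: "f = g"
    if "f \<in> Hom C A B" "g \<in> Hom C A B" "FA f = FA g" for f g A B
    using ff[of A B] that F.dom.Hom_Ob[OF that(1)] by (auto simp: bij_betw_def inj_on_def)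
  \<comment> \<open>Conjugation of \<open>g\<close> by the chosen isomorphisms, pulled back along
    \<open>FA\<close>.\<close>
  define GA where "GA g = pre (GO (Dom D g)) (GO (Cod D g)) (e' (Cod D g) \<cdot>\<^bsub>D\<^esub> (g \<cdot>\<^bsub>D\<^esub> e (Dom D g)))" for g
  have GA: "GA g \<in> Hom C (GO X) (GO Y)" "FA (GA g) = e' Y \<cdot>\<^bsub>D\<^esub> (g \<cdot>\<^bsub>D\<^esub> e X)"
    if "g \<in> Hom D X Y" for g X Y
  proof -
    note Ob = F.cod.Hom_Ob[OF that]
    show "GA g \<in> Hom C (GO X) (GO Y)" "FA (GA g) = e' Y \<cdot>\<^bsub>D\<^esub> (g \<cdot>\<^bsub>D\<^esub> e X)"
      using pre[OF GO[OF Ob(1)] GO[OF Ob(2)]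
          F.cod.Comp_in_Hom[OF F.cod.Comp_in_Hom[OF e[OF Ob(1)] that] e'[OF Ob(2)]]] HomD[OF that]
      by (simp_all add: GA_def)
  qed
  \<comment> \<open>Naturality of \<open>e\<close>. Since \<open>e\<close> can be cancelled, it also
    yields compatibility of \<open>GA\<close> with composition.\<close>
  have eFAGA: "e Y \<cdot>\<^bsub>D\<^esub> FA (GA g) = g \<cdot>\<^bsub>D\<^esub> e X" if g: "g \<in> Hom D X Y" for g X Y
  proof -
    note Ob = F.cod.Hom_Ob[OF g]
    note ge = F.cod.Comp_in_Hom[OF e[OF Ob(1)] g]
    show ?thesis
      using F.cod.Comp_assoc[OF ge e'[OF Ob(2)] e[OF Ob(2)]] GA(2)[OF g] ee'[OF Ob(2)]
        F.cod.Comp_Ident_left[OF ge] by simp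
  qed
  have e_mono: "a = b" if "a \<in> Hom D W (FO (GO B))" "b \<in> Hom D W (FO (GO B))" "e B \<cdot>\<^bsub>D\<^esub> a = e B \<cdot>\<^bsub>D\<^esub> b"
    "B \<in> Ob D" for a b W B
    using F.cod.Comp_assoc[OF that(1) e e'] F.cod.Comp_assoc[OF that(2) e e'] e'e[OF that(4)] that(3,4)
      F.cod.Comp_Ident_left[OF that(1)] F.cod.Comp_Ident_left[OF that(2)] by simp
  have G: "category_functor D C GO GA"
  proof
    show "GA (Ident D X) = Ident C (GO X)" if X: "X \<in> Ob D" for X
    proof (rule faithful)
      show "GA (Ident D X) \<in> Hom C (GO X) (GO X)"
        using GA F.cod.Ident_in_Hom X by blast
      show "Ident C (GO X) \<in> Hom C (GO X) (GO X)"
        using F.dom.Ident_in_Hom GO X by blast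
      show "FA (GA (Ident D X)) = FA (Ident C (GO X))"
        using GA(2)[OF F.cod.Ident_in_Hom[OF X]] F.cod.Comp_Ident_left[OF e[OF X]] e'e[OF X]
          F.maps_Ident[OF GO[OF X]] by simp
    qed
    show "GA (g \<cdot>\<^bsub>D\<^esub> f) = GA g \<cdot>\<^bsub>C\<^esub> GA f" if f: "f \<in> Hom D X Y" and g: "g \<in> Hom D Y Z" for f g X Y Z
    proof (rule faithful)
      note gf = F.cod.Comp_in_Hom[OF f g] and GG = F.dom.Comp_in_Hom[OF GA(1)[OF f] GA(1)[OF g]]
      note FF = F.maps_Hom[OF GA(1)[OF f]] F.maps_Hom[OF GA(1)[OF g]]
      note Ob = F.cod.Hom_Ob[OF f] F.cod.Hom_Ob[OF g]
      show "GA (g \<cdot>\<^bsub>D\<^esub> f) \<in> Hom C (GO X) (GO Z)" using GA gf by blast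
      show "GA g \<cdot>\<^bsub>C\<^esub> GA f \<in> Hom C (GO X) (GO Z)" using GG .
      have "e Z \<cdot>\<^bsub>D\<^esub> (FA (GA g) \<cdot>\<^bsub>D\<^esub> FA (GA f)) = (g \<cdot>\<^bsub>D\<^esub> f) \<cdot>\<^bsub>D\<^esub> e X"
        using F.cod.Comp_assoc[OF FF e[OF Ob(4)]] F.cod.Comp_assoc[OF FF(1) e[OF Ob(3)] g]
          F.cod.Comp_assoc[OF e[OF Ob(1)] f g] eFAGA[OF f] eFAGA[OF g] by simp
      then have "e Z \<cdot>\<^bsub>D\<^esub> FA (GA (g \<cdot>\<^bsub>D\<^esub> f)) = e Z \<cdot>\<^bsub>D\<^esub> FA (GA g \<cdot>\<^bsub>C\<^esub> GA f)"
        using eFAGA[OF gf] F.maps_Comp[OF GA(1)[OF f] GA(1)[OF g]] by simp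
      then show "FA (GA (g \<cdot>\<^bsub>D\<^esub> f)) = FA (GA g \<cdot>\<^bsub>C\<^esub> GA f)"
        using e_mono F.maps_Hom[OF GA(1)[OF gf]] F.maps_Hom[OF GG] Ob(4) by blast
    qed
  qed (use GO GA in auto)
  \<comment> \<open>The unit at \<open>A\<close> is the arrow that \<open>FA\<close> sends to
    \<open>e' (FO A)\<close>.\<close>
  define \<eta> where "\<eta> A = pre A (GO (FO A)) (e' (FO A))" for A
  have \<eta>: "\<eta> A \<in> Hom C A (GO (FO A))" "FA (\<eta> A) = e' (FO A)" if "A \<in> Ob C" for A
    unfolding \<eta>_def using pre that GO F.maps_Ob e' by simp_all
  have \<eta>_iso: "is_iso C (\<eta> A)" if A: "A \<in> Ob C" for A
  proof -
    note FA = F.maps_Ob[OF A]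
    note GFA = GO[OF FA]
    \<comment> \<open>\<open>FA\<close> sends this arrow to the inverse of
      \<open>FA (\<eta> A)\<close>, so it is inverse to \<open>\<eta> A\<close> by
      faithfulness.\<close>
    define \<theta> where "\<theta> = pre (GO (FO A)) A (e (FO A))"
    have \<theta>: "\<theta> \<in> Hom C (GO (FO A)) A" "FA \<theta> = e (FO A)"
      unfolding \<theta>_def using pre GFA A e[OF FA] by simp_all
    show ?thesis
    proof (rule is_isoI[OF \<eta>(1)[OF A] \<theta>(1)])
      show "\<theta> \<cdot>\<^bsub>C\<^esub> \<eta> A = Ident C A"
        by (rule faithful[OF F.dom.Comp_in_Hom[OF \<eta>(1)[OF A] \<theta>(1)] F.dom.Ident_in_Hom[OF A]])
          (simp add: F.maps_Comp[OF \<eta>(1)[OF A] \<theta>(1)] \<theta> \<eta>(2)[OF A] F.maps_Ident A ee' FA)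
      show "\<eta> A \<cdot>\<^bsub>C\<^esub> \<theta> = Ident C (GO (FO A))"
        by (rule faithful[OF F.dom.Comp_in_Hom[OF \<theta>(1) \<eta>(1)[OF A]] F.dom.Ident_in_Hom[OF GFA]])
          (simp add: F.maps_Comp[OF \<theta>(1) \<eta>(1)[OF A]] \<theta> \<eta>(2)[OF A] F.maps_Ident GFA e'e FA)
    qed
  qed
  have \<eta>_nat: "\<eta> (Cod C f) \<cdot>\<^bsub>C\<^esub> f = GA (FA f) \<cdot>\<^bsub>C\<^esub> \<eta> (Dom C f)" if "f \<in> Arr C" for f
  proof -
    define X Y where "X = Dom C f" and "Y = Cod C f"
    have f: "f \<in> Hom C X Y" using that by (simp add: X_def Y_def Hom_def)
    note Ob = F.dom.Hom_Ob[OF f] and Ff = F.maps_Hom[OF f]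
    note FOb = F.maps_Ob[OF Ob(1)] F.maps_Ob[OF Ob(2)]
    note l = F.dom.Comp_in_Hom[OF f \<eta>(1)[OF Ob(2)]] and r = F.dom.Comp_in_Hom[OF \<eta>(1)[OF Ob(1)] GA(1)[OF Ff]]
    have "FA (\<eta> Y \<cdot>\<^bsub>C\<^esub> f) = e' (FO Y) \<cdot>\<^bsub>D\<^esub> FA f"
      using F.maps_Comp[OF f \<eta>(1)[OF Ob(2)]] \<eta>(2)[OF Ob(2)] by simp
    moreover have "FA (GA (FA f) \<cdot>\<^bsub>C\<^esub> \<eta> X) = (e' (FO Y) \<cdot>\<^bsub>D\<^esub> (FA f \<cdot>\<^bsub>D\<^esub> e (FO X))) \<cdot>\<^bsub>D\<^esub> e' (FO X)"
      using F.maps_Comp[OF \<eta>(1)[OF Ob(1)] GA(1)[OF Ff]] \<eta>(2)[OF Ob(1)] GA(2)[OF Ff] by simp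
    moreover have "\<dots> = e' (FO Y) \<cdot>\<^bsub>D\<^esub> FA f"
      using F.cod.Comp_assoc[OF e'[OF FOb(1)] F.cod.Comp_in_Hom[OF e[OF FOb(1)] Ff] e'[OF FOb(2)]]
        F.cod.Comp_assoc[OF e'[OF FOb(1)] e[OF FOb(1)] Ff] ee'[OF FOb(1)] F.cod.Comp_Ident_right[OF Ff]
      by simp
    ultimately have "\<eta> Y \<cdot>\<^bsub>C\<^esub> f = GA (FA f) \<cdot>\<^bsub>C\<^esub> \<eta> X" using faithful[OF l r] by simp
    then show ?thesis by (simp add: X_def Y_def)
  qed
  have "natural_iso C C id id (GO \<circ> FO) (GA \<circ> FA) \<eta>"
    unfolding natural_iso_def using \<eta> \<eta>_iso \<eta>_nat by simp
  \<comment> \<open>The counit is \<open>e\<close> itself.\<close>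
  moreover have "natural_iso D D (FO \<circ> GO) (FA \<circ> GA) id id e"
    unfolding natural_iso_def using e is_isoI[OF e e' e'e ee'] eFAGA[OF Arr_in_Hom] by simp
  ultimately show ?thesis
    unfolding equivalent_categories_def using F.category_functor_axioms G by blast
qed

section \<open>Abelian categories\<close>

context preadditive_category
begin

lemma hom_group_simps [simp]:
  "carrier (hom_group C A B) = Hom C A B"
  "mult (hom_group C A B) = Add C"
  "one (hom_group C A B) = Zero C A B"
  by (simp_all add: hom_group_def)

lemma hom_group_group: "f \<in> Hom C A B \<Longrightarrow> group (hom_group C A B)"
  using hom_comm_group Hom_Ob comm_group.axioms(2) by blast

lemma Zero_in_Hom:
  assumes "A \<in> Ob C" "B \<in> Ob C"
  shows "Zero C A B \<in> Hom C A B"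
  using monoid.one_closed[OF group.is_monoid[OF comm_group.axioms(2)[OF hom_comm_group[OF assms]]]]
  by simp

lemma Add_in_Hom:
  assumes "f \<in> Hom C A B" "g \<in> Hom C A B"
  shows "Add C f g \<in> Hom C A B"
  using monoid.m_closed[OF group.is_monoid[OF hom_group_group[OF assms(1)]], of f g] assms by simp

lemma Add_Zero_left: "f \<in> Hom C A B \<Longrightarrow> Add C (Zero C A B) f = f"
  using monoid.l_one[OF group.is_monoid[OF hom_group_group], of f A B f] by simp

lemma Add_Zero_right: "f \<in> Hom C A B \<Longrightarrow> Add C f (Zero C A B) = f"
  using monoid.r_one[OF group.is_monoid[OF hom_group_group], of f A B f] by simp

lemma Add_right_cancel:
  assumes "f \<in> Hom C A B" "g \<in> Hom C A B" "h \<in> Hom C A B"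
  shows "Add C f h = Add C g h \<longleftrightarrow> f = g"
  using group.right_cancel[OF hom_group_group[OF assms(1)], of h f g] assms by simp

lemma Diff_in_Hom:
  assumes "f \<in> Hom C A B" "g \<in> Hom C A B"
  shows "Diff C f g \<in> Hom C A B"
  using group.inv_closed[OF hom_group_group[OF assms(1)], of g] assms HomD[OF assms(2)] Add_in_Hom
  by (simp add: Diff_def)

lemma Add_Diff_cancel:
  assumes "f \<in> Hom C A B" "g \<in> Hom C A B"
  shows "Add C (Diff C f g) g = f"
proof -
  interpret G: group "hom_group C A B" using hom_group_group[OF assms(1)] .
  show ?thesis
    using G.inv_closed[of g] G.m_assoc[of f "inv\<^bsub>hom_group C A B\<^esub> g" g] G.l_inv[of g]
      assms HomD[OF assms(2)] Add_Zero_right[OF assms(1)]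
    by (simp add: Diff_def)
qed

text \<open>Since 0 + 0 = 0, the composite added to itself is itself; cancelling one copy in the
  Hom-group leaves zero.\<close>

lemma Comp_Zero_right:
  assumes "g \<in> Hom C B D" "A \<in> Ob C"
  shows "g \<cdot> Zero C A B = Zero C A D"
proof -
  note Z = Zero_in_Hom[OF assms(2) Hom_Ob(1)[OF assms(1)]]
  note gZ = Comp_in_Hom[OF Z assms(1)]
  have "Add C (g \<cdot> Zero C A B) (g \<cdot> Zero C A B) = Add C (Zero C A D) (g \<cdot> Zero C A B)"
    using Comp_Add_right[OF Z Z assms(1)] Add_Zero_left[OF Z] Add_Zero_left[OF gZ] by simp
  then show ?thesis using Add_right_cancel gZ Zero_in_Hom Hom_Ob[OF gZ] by blast
qed

lemma Comp_Zero_left: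
  assumes "f \<in> Hom C A B" "D \<in> Ob C"
  shows "Zero C B D \<cdot> f = Zero C A D"
proof -
  note Z = Zero_in_Hom[OF Hom_Ob(2)[OF assms(1)] assms(2)]
  note gZ = Comp_in_Hom[OF assms(1) Z]
  have "Add C (Zero C B D \<cdot> f) (Zero C B D \<cdot> f) = Add C (Zero C A D) (Zero C B D \<cdot> f)"
    using Comp_Add_left[OF assms(1) Z Z] Add_Zero_left[OF Z] Add_Zero_left[OF gZ] by simp
  then show ?thesis using Add_right_cancel gZ Zero_in_Hom Hom_Ob[OF gZ] by blast
qed

text \<open>Adding \<open>g \<cdot> h\<close> back to the composite with the difference gives
  \<open>f \<cdot> h\<close>, so cancellation settles both directions and inverses never have to be
  composed.\<close>

lemma Comp_Diff_left_eq_Zero_iff: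
  assumes f: "f \<in> Hom C A B" and g: "g \<in> Hom C A B" and h: "h \<in> Hom C W A"
  shows "Diff C f g \<cdot> h = Zero C W B \<longleftrightarrow> f \<cdot> h = g \<cdot> h"
proof -
  note d = Diff_in_Hom[OF f g]
  have "Add C (Diff C f g \<cdot> h) (g \<cdot> h) = f \<cdot> h"
    using Comp_Add_left[OF h d g] Add_Diff_cancel[OF f g] by simp
  then show ?thesis
    using Add_right_cancel[OF Comp_in_Hom[OF h d] Zero_in_Hom Comp_in_Hom[OF h g]]
      Add_Zero_left[OF Comp_in_Hom[OF h g]] Hom_Ob(1)[OF h] Hom_Ob(2)[OF f] by auto
qed

lemma Comp_Diff_right_eq_Zero_iff:
  assumes f: "f \<in> Hom C A B" and g: "g \<in> Hom C A B" and h: "h \<in> Hom C B W"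
  shows "h \<cdot> Diff C f g = Zero C A W \<longleftrightarrow> h \<cdot> f = h \<cdot> g"
proof -
  note d = Diff_in_Hom[OF f g]
  have "Add C (h \<cdot> Diff C f g) (h \<cdot> g) = h \<cdot> f"
    using Comp_Add_right[OF d g h] Add_Diff_cancel[OF f g] by simp
  then show ?thesis
    using Add_right_cancel[OF Comp_in_Hom[OF d h] Zero_in_Hom Comp_in_Hom[OF g h]]
      Add_Zero_left[OF Comp_in_Hom[OF g h]] Hom_Ob(2)[OF h] Hom_Ob(1)[OF f] by auto
qed

section \<open>Monomorphisms, kernels and cokernels\<close>

lemma is_monoI:
  assumes m: "m \<in> Hom C A B"
    and 0: "\<And>W x. x \<in> Hom C W A \<Longrightarrow> m \<cdot> x = Zero C W B \<Longrightarrow> x = Zero C W A"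
  shows "is_mono C m"
proof -
  have "g = h" if g: "g \<in> Hom C W A" and h: "h \<in> Hom C W A" and eq: "m \<cdot> g = m \<cdot> h" for W g h
  proof -
    note Ob = Hom_Ob[OF g]
    \<comment> \<open>Two arrows with equal composites have a difference that \<open>m\<close>
      kills.\<close>
    have "Diff C g h = Zero C W A"
      using 0[OF Diff_in_Hom[OF g h]] Comp_Diff_right_eq_Zero_iff[OF g h m] eq by simp
    then show ?thesis using Add_Diff_cancel[OF g h] Add_Zero_left[OF h] by simp
  qed
  then show ?thesis using HomD[OF m] unfolding is_mono_def by blast
qed

lemma is_kernelD:
  assumes "is_kernel C f k" "f \<in> Hom C A B" "k \<in> Hom C K A"
  shows "f \<cdot> k = Zero C K B"
    and "g \<in> Hom C W A \<Longrightarrow> f \<cdot> g = Zero C W B \<Longrightarrow> \<exists>u \<in> Hom C W K. k \<cdot> u = g"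
proof -
  have *: "f \<cdot> k = Zero C K B" "\<forall>W \<in> Ob C. \<forall>g \<in> Hom C W A. f \<cdot> g = Zero C W B \<longrightarrow>
      (\<exists>!u. u \<in> Hom C W K \<and> k \<cdot> u = g)"
    using assms(1) HomD[OF assms(2)] HomD[OF assms(3)] unfolding is_kernel_def by simp_all
  show "f \<cdot> k = Zero C K B" by fact
  show "\<exists>u \<in> Hom C W K. k \<cdot> u = g" if "g \<in> Hom C W A" "f \<cdot> g = Zero C W B"
    using *(2)[rule_format, OF Hom_Ob(1)[OF that(1)] that] by blast
qed

lemma is_cokernelD:
  assumes "is_cokernel C f c" "f \<in> Hom C A B" "c \<in> Hom C B K"
  shows "c \<cdot> f = Zero C A K"
    and "g \<in> Hom C B W \<Longrightarrow> g \<cdot> f = Zero C A W \<Longrightarrow> \<exists>u \<in> Hom C K W. u \<cdot> c = g"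
proof -
  have *: "c \<cdot> f = Zero C A K" "\<forall>W \<in> Ob C. \<forall>g \<in> Hom C B W. g \<cdot> f = Zero C A W \<longrightarrow>
      (\<exists>!u. u \<in> Hom C K W \<and> u \<cdot> c = g)"
    using assms(1) HomD[OF assms(2)] HomD[OF assms(3)] unfolding is_cokernel_def by simp_all
  show "c \<cdot> f = Zero C A K" by fact
  show "\<exists>u \<in> Hom C K W. u \<cdot> c = g" if "g \<in> Hom C B W" "g \<cdot> f = Zero C A W"
    using *(2)[rule_format, OF Hom_Ob(2)[OF that(1)] that] by blast
qed

lemma is_kernelI:
  assumes "f \<in> Hom C A B" "k \<in> Hom C K A" "is_mono C k" "f \<cdot> k = Zero C K B"
    and "\<And>W g. g \<in> Hom C W A \<Longrightarrow> f \<cdot> g = Zero C W B \<Longrightarrow> \<exists>u \<in> Hom C W K. k \<cdot> u = g"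
  shows "is_kernel C f k"
proof -
  have "\<exists>!u. u \<in> Hom C W K \<and> k \<cdot> u = g" if "g \<in> Hom C W A" "f \<cdot> g = Zero C W B" for W g
    using assms(5)[OF that] is_monoD[OF assms(3,2)] by blast
  then show ?thesis
    using assms(4) HomD[OF assms(1)] HomD[OF assms(2)] unfolding is_kernel_def by simp
qed

lemma is_cokernelI:
  assumes "f \<in> Hom C A B" "c \<in> Hom C B K" "is_epi C c" "c \<cdot> f = Zero C A K"
    and "\<And>W g. g \<in> Hom C B W \<Longrightarrow> g \<cdot> f = Zero C A W \<Longrightarrow> \<exists>u \<in> Hom C K W. u \<cdot> c = g"
  shows "is_cokernel C f c"
proof -
  have "\<exists>!u. u \<in> Hom C K W \<and> u \<cdot> c = g" if "g \<in> Hom C B W" "g \<cdot> f = Zero C A W" for W g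
    using assms(5)[OF that] is_epiD[OF assms(3,2)] by blast
  then show ?thesis
    using assms(4) HomD[OF assms(1)] HomD[OF assms(2)] unfolding is_cokernel_def by simp
qed

text \<open>The uniqueness half of the universal property does it: if
  \<open>g \<cdot> c = h \<cdot> c\<close>, then \<open>g\<close> and \<open>h\<close> factor the
  same arrow, which kills \<open>f\<close>, through \<open>c\<close>.\<close>

lemma is_cokernel_epi:
  assumes c: "is_cokernel C f c"
  shows "is_epi C c"
  unfolding is_epi_def
proof (intro conjI ballI impI)
  show "c \<in> Arr C" using c by (simp add: is_cokernel_def)
  fix W g h
  assume W: "W \<in> Ob C" and g: "g \<in> Hom C (Cod C c) W" and h: "h \<in> Hom C (Cod C c) W"
    and eq: "g \<cdot> c = h \<cdot> c"
  have c': "c \<in> Hom C (Cod C f) (Cod C c)" and f: "f \<in> Hom C (Dom C f) (Cod C f)"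
    and cf: "c \<cdot> f = Zero C (Dom C f) (Cod C c)"
    using c by (auto simp: is_cokernel_def Hom_def)
  have "(g \<cdot> c) \<cdot> f = Zero C (Dom C f) W"
    using Comp_assoc[OF f c' g] cf Comp_Zero_right[OF g Hom_Ob(1)[OF f]] by simp
  then have "\<exists>!u. u \<in> Hom C (Cod C c) W \<and> u \<cdot> c = g \<cdot> c"
    using c W Comp_in_Hom[OF c' g] unfolding is_cokernel_def by blast
  then obtain u where "\<And>v. v \<in> Hom C (Cod C c) W \<Longrightarrow> v \<cdot> c = g \<cdot> c \<Longrightarrow> v = u" by blast
  from this[OF g refl] this[OF h eq[symmetric]] show "g = h" by simp
qed

end

section \<open>Short exact sequences\<close>

context abelian_category
begin

text \<open>The monomorphism \<open>m\<close> is the kernel of some \<open>g\<close>, and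
  \<open>g\<close> factors through \<open>c\<close>. Hence whatever \<open>c\<close> kills is killed
  by \<open>g\<close> and factors through \<open>m\<close>.\<close>

lemma is_kernel_of_cokernel:
  assumes m: "is_mono C m" and c: "is_cokernel C m c"
  shows "is_kernel C c m"
proof -
  obtain g where g: "is_kernel C g m" using mono_is_kernel[OF m] by blast
  define A B D E where "A = Dom C m" and "B = Cod C m" and "D = Cod C c" and "E = Cod C g"
  have m': "m \<in> Hom C A B" and c': "c \<in> Hom C B D" and g': "g \<in> Hom C B E"
    using g c by (auto simp: is_kernel_def is_cokernel_def Hom_def A_def B_def D_def E_def)
  obtain u where u: "u \<in> Hom C D E" "u \<cdot> c = g"
    using is_cokernelD(2)[OF c m' c' g'] is_kernelD(1)[OF g g' m'] by blast
  show ?thesis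
  proof (rule is_kernelI[OF c' m' m is_cokernelD(1)[OF c m' c']])
    fix W x assume x: "x \<in> Hom C W B" "c \<cdot> x = Zero C W D"
    have "g \<cdot> x = Zero C W E"
      using Comp_assoc[OF x(1) c' u(1)] x u Comp_Zero_right[OF u(1) Hom_Ob(1)[OF x(1)]] by simp
    then show "\<exists>v \<in> Hom C W A. m \<cdot> v = x" using is_kernelD(2)[OF g g' m' x(1)] by blast
  qed
qed

text \<open>\<open>short_exact\<close> only says that some image \<open>m\<close> of
  \<open>i\<close> is a kernel of \<open>p\<close>. Both \<open>i\<close> and \<open>m\<close> are
  kernels of a cokernel \<open>c\<close> of \<open>i\<close>, so they represent the same subobject
  and \<open>i\<close> can replace \<open>m\<close>.\<close>

lemma short_exact_is_kernel:
  assumes "short_exact C A E B i p"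
  shows "is_kernel C p i"
proof -
  have i: "i \<in> Hom C A E" "is_mono C i" and p: "p \<in> Hom C E B"
    using assms by (auto simp: short_exact_def)
  obtain m c where c: "is_cokernel C i c" and mc: "is_kernel C c m" and mp: "is_kernel C p m"
    using assms unfolding short_exact_def is_image_def by blast
  define K M where "K = Cod C c" and "M = Dom C m"
  have c': "c \<in> Hom C E K" using c HomD[OF i(1)] by (auto simp: is_cokernel_def Hom_def K_def)
  have m': "m \<in> Hom C M E" using mp HomD[OF p] by (auto simp: is_kernel_def Hom_def M_def)
  have ic: "is_kernel C c i" using is_kernel_of_cokernel[OF i(2) c] .
  obtain u where u: "u \<in> Hom C A M" "m \<cdot> u = i"
    using is_kernelD(2)[OF mc c' m' i(1)] is_kernelD(1)[OF ic c' i(1)] by blast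
  show ?thesis
  proof (rule is_kernelI[OF p i])
    show "p \<cdot> i = Zero C A B"
      using Comp_assoc[OF u(1) m' p] u is_kernelD(1)[OF mp p m']
        Comp_Zero_left[OF u(1) Hom_Ob(2)[OF p]] by simp
    fix W x assume x: "x \<in> Hom C W E" "p \<cdot> x = Zero C W B"
    obtain v where v: "v \<in> Hom C W M" "m \<cdot> v = x" using is_kernelD(2)[OF mp p m' x] by blast
    have "c \<cdot> x = Zero C W K"
      using Comp_assoc[OF v(1) m' c'] v is_kernelD(1)[OF mc c' m']
        Comp_Zero_left[OF v(1) Hom_Ob(2)[OF c']] by simp
    then show "\<exists>v \<in> Hom C W A. i \<cdot> v = x" using is_kernelD(2)[OF ic c' i(1) x(1)] by blast
  qed
qed

text \<open>The epimorphism \<open>p\<close> is a cokernel of some \<open>g\<close>, and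
  \<open>g\<close> factors through \<open>i\<close>, the kernel of \<open>p\<close>. So an arrow
  that kills \<open>i\<close> kills \<open>g\<close> and factors through \<open>p\<close>.\<close>

lemma short_exact_is_cokernel:
  assumes "short_exact C A E B i p"
  shows "is_cokernel C i p"
proof -
  have i: "i \<in> Hom C A E" "is_mono C i" and p: "p \<in> Hom C E B" "is_epi C p"
    using assms by (auto simp: short_exact_def)
  note k = short_exact_is_kernel[OF assms]
  obtain g where g: "is_cokernel C g p" using epi_is_cokernel[OF p(2)] by blast
  define K where "K = Dom C g"
  have g': "g \<in> Hom C K E" using g HomD[OF p(1)] by (auto simp: is_cokernel_def Hom_def K_def)
  obtain u where u: "u \<in> Hom C K A" "i \<cdot> u = g"
    using is_kernelD(2)[OF k p(1) i(1) g'] is_cokernelD(1)[OF g g' p(1)] by blast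
  show ?thesis
  proof (rule is_cokernelI[OF i(1) p is_kernelD(1)[OF k p(1) i(1)]])
    fix W x assume x: "x \<in> Hom C E W" "x \<cdot> i = Zero C A W"
    have "x \<cdot> g = Zero C K W"
      using Comp_assoc[OF u(1) i(1) x(1)] u x Comp_Zero_left[OF u(1) Hom_Ob(2)[OF x(1)]] by simp
    then show "\<exists>v \<in> Hom C B W. v \<cdot> p = x" using is_cokernelD(2)[OF g g' p(1) x(1)] by blast
  qed
qed

text \<open>The monomorphism \<open>i\<close> is its own image, being the kernel of its cokernel
  \<open>p\<close>.\<close>

lemma short_exactI:
  assumes "i \<in> Hom C A E" "p \<in> Hom C E B" "is_mono C i" "is_cokernel C i p"
  shows "short_exact C A E B i p"
  unfolding short_exact_def is_image_def
  using assms is_cokernel_epi is_kernel_of_cokernel by blast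

section \<open>Vanishing of the first Ext group as an extension property\<close>

lemma Ext1_vanishes_retraction:
  assumes ext: "Ext1_vanishes C X A" and s: "short_exact C A E X i p"
  shows "\<exists>r \<in> Hom C E A. r \<cdot> i = Ident C A"
proof -
  have i: "i \<in> Hom C A E" and p: "p \<in> Hom C E X" using s by (auto simp: short_exact_def)
  have "(E, i, p) \<in> extensions C X A" using s by (simp add: extensions_def)
  then have "extension_rel C X A `` {(E, i, p)} = Ext1_zero C X A"
    using ext quotientI[of _ "extensions C X A" "extension_rel C X A"]
    unfolding Ext1_vanishes_def Ext1_def by simp
  moreover have "((E, i, p), (E, i, p)) \<in> extension_rel C X A"
    using s Ident_in_Hom[OF Hom_Ob(2)[OF i]] is_iso_Ident[OF Hom_Ob(2)[OF i]]
      Comp_Ident_left[OF i] Comp_Ident_right[OF p]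
    by (auto simp: extension_rel_def extensions_def)
  \<comment> \<open>The only class is the zero class, so the given extension is isomorphic, under
    \<phi>, to a biproduct; the projection \<open>pA\<close> after the inverse of \<phi> is the
    retraction.\<close>
  ultimately have "(E, i, p) \<in> Ext1_zero C X A" by blast
  then obtain P iA pX iX pA \<phi> where bi: "is_biproduct C A X P iA iX pA pX"
    and \<phi>: "\<phi> \<in> Hom C P E" "is_iso C \<phi>" "\<phi> \<cdot> iA = i"
    unfolding Ext1_zero_def extension_rel_def by blast
  obtain \<psi> where \<psi>: "\<psi> \<in> Hom C E P" "\<psi> \<cdot> \<phi> = Ident C P" using is_isoE[OF \<phi>(2,1)] by metis
  have iA: "iA \<in> Hom C A P" and pA: "pA \<in> Hom C P A" and pi: "pA \<cdot> iA = Ident C A"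
    using bi by (auto simp: is_biproduct_def)
  have "\<psi> \<cdot> i = iA"
    using Comp_assoc[OF iA \<phi>(1) \<psi>(1)] \<phi> \<psi> Comp_Ident_left[OF iA] by simp
  then have "(pA \<cdot> \<psi>) \<cdot> i = Ident C A"
    using Comp_assoc[OF i \<psi>(1) pA] pi by simp
  then show ?thesis using Comp_in_Hom[OF \<psi>(1) pA] by blast
qed

text \<open>\<open>E\<close> is the pushout of \<open>i\<close> along \<open>f\<close>, built as the
  cokernel of the arrow \<alpha> from \<open>A\<close> to the biproduct of \<open>B\<close> and
  \<open>D\<close> with components \<open>i\<close> and minus \<open>f\<close>. The map
  \<open>q\<close> is induced by \<open>p\<close> on the summand \<open>B\<close> and by zero on
  \<open>D\<close>.\<close>

lemma short_exact_pushout: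
  assumes s: "short_exact C A B X i p" and f: "f \<in> Hom C A D"
  shows "\<exists>E j q h. short_exact C D E X j q \<and> h \<in> Hom C B E \<and> h \<cdot> i = j \<cdot> f"
proof -
  have i: "i \<in> Hom C A B" "is_mono C i" and p: "p \<in> Hom C B X" "is_epi C p"
    using s by (auto simp: short_exact_def)
  note cok = short_exact_is_cokernel[OF s]
  note Ob = Hom_Ob[OF i(1)] Hom_Ob[OF p(1)] Hom_Ob[OF f]
  obtain P iB iD pB pD where bi: "is_biproduct C B D P iB iD pB pD"
    using ex_biproduct Ob by blast
  have P: "P \<in> Ob C" and iB: "iB \<in> Hom C B P" and iD: "iD \<in> Hom C D P"
    and pB: "pB \<in> Hom C P B" and pD: "pD \<in> Hom C P D"
    and pi: "pB \<cdot> iB = Ident C B" "pD \<cdot> iD = Ident C D" "pB \<cdot> iD = Zero C D B"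
    and sum: "Add C (iB \<cdot> pB) (iD \<cdot> pD) = Ident C P"
    using bi by (auto simp: is_biproduct_def)
  note iBi = Comp_in_Hom[OF i(1) iB] and iDf = Comp_in_Hom[OF f iD]
  define \<alpha> where "\<alpha> = Diff C (iB \<cdot> i) (iD \<cdot> f)"
  have \<alpha>: "\<alpha> \<in> Hom C A P" unfolding \<alpha>_def by (rule Diff_in_Hom[OF iBi iDf])
  \<comment> \<open>The \<open>B\<close> component of \<alpha> is the monomorphism \<open>i\<close>;
    this makes \<alpha> monic, hence the kernel of its cokernel.\<close>
  have pB\<alpha>: "pB \<cdot> \<alpha> = i"
  proof -
    have "pB \<cdot> (iD \<cdot> f) = Zero C A B"
      using Comp_assoc[OF f iD pB] pi(3) Comp_Zero_left[OF f Ob(2)] by simp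
    moreover have "pB \<cdot> (iB \<cdot> i) = i"
      using Comp_assoc[OF i(1) iB pB] pi(1) Comp_Ident_left[OF i(1)] by simp
    moreover have "Add C (pB \<cdot> \<alpha>) (pB \<cdot> (iD \<cdot> f)) = pB \<cdot> (iB \<cdot> i)"
      using Comp_Add_right[OF \<alpha> iDf pB] Add_Diff_cancel[OF iBi iDf] by (simp add: \<alpha>_def)
    ultimately show ?thesis using Add_Zero_right[OF Comp_in_Hom[OF \<alpha> pB]] by simp
  qed
  have \<alpha>_mono: "is_mono C \<alpha>"
  proof (rule is_monoI[OF \<alpha>])
    fix W x assume x: "x \<in> Hom C W A" "\<alpha> \<cdot> x = Zero C W P"
    have "i \<cdot> x = Zero C W B"
      using Comp_assoc[OF x(1) \<alpha> pB] pB\<alpha> x Comp_Zero_right[OF pB Hom_Ob(1)[OF x(1)]] by simp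
    then have "i \<cdot> x = i \<cdot> Zero C W A" using Comp_Zero_right[OF i(1) Hom_Ob(1)[OF x(1)]] by simp
    then show "x = Zero C W A"
      using is_monoD[OF i(2,1) x(1)] Zero_in_Hom[OF Hom_Ob[OF x(1)]] by blast
  qed
  obtain c where c: "is_cokernel C \<alpha> c" using ex_cokernel HomD(1)[OF \<alpha>] by blast
  define E where "E = Cod C c"
  have c': "c \<in> Hom C P E" using c HomD[OF \<alpha>] by (auto simp: is_cokernel_def Hom_def E_def)
  note ker = is_kernel_of_cokernel[OF \<alpha>_mono c] and c_epi = is_cokernel_epi[OF c]
  note cB = Comp_in_Hom[OF iB c'] and j = Comp_in_Hom[OF iD c'] and ppB = Comp_in_Hom[OF pB p(1)]
  have square: "(c \<cdot> iB) \<cdot> i = (c \<cdot> iD) \<cdot> f"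
    using Comp_Diff_right_eq_Zero_iff[OF iBi iDf c'] is_cokernelD(1)[OF c \<alpha> c']
      Comp_assoc[OF i(1) iB c'] Comp_assoc[OF f iD c'] by (simp add: \<alpha>_def)
  \<comment> \<open>If \<open>c\<close> kills \<open>iD \<cdot> x\<close>, this arrow is
    \<open>\<alpha> \<cdot> y\<close> for some \<open>y\<close>. Its \<open>B\<close> component is
    both \<open>i \<cdot> y\<close> and zero, so \<open>y\<close> and then \<open>x\<close>
    vanish.\<close>
  have j_mono: "is_mono C (c \<cdot> iD)"
  proof (rule is_monoI[OF j])
    fix W x assume x: "x \<in> Hom C W D" "(c \<cdot> iD) \<cdot> x = Zero C W E"
    note W = Hom_Ob(1)[OF x(1)]
    have "c \<cdot> (iD \<cdot> x) = Zero C W E" using Comp_assoc[OF x(1) iD c'] x by simp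
    then obtain y where y: "y \<in> Hom C W A" "\<alpha> \<cdot> y = iD \<cdot> x"
      using is_kernelD(2)[OF ker c' \<alpha> Comp_in_Hom[OF x(1) iD]] by blast
    have "i \<cdot> y = pB \<cdot> (iD \<cdot> x)"
      using Comp_assoc[OF y(1) \<alpha> pB] pB\<alpha> y by simp
    also have "\<dots> = i \<cdot> Zero C W A"
      using Comp_assoc[OF x(1) iD pB] pi(3) Comp_Zero_left[OF x(1) Ob(2)] Comp_Zero_right[OF i(1) W] by simp
    finally have "y = Zero C W A"
      using is_monoD[OF i(2,1) y(1)] Zero_in_Hom[OF W Ob(1)] by blast
    then have "iD \<cdot> x = Zero C W P" using y Comp_Zero_right[OF \<alpha> W] by simp
    then show "x = Zero C W D"
      using Comp_assoc[OF x(1) iD pD] pi(2) Comp_Ident_left[OF x(1)] Comp_Zero_right[OF pD W] by simp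
  qed
  have "(p \<cdot> pB) \<cdot> \<alpha> = Zero C A X"
    using Comp_assoc[OF \<alpha> pB p(1)] pB\<alpha> is_cokernelD(1)[OF cok i(1) p(1)] by simp
  then obtain q where q: "q \<in> Hom C E X" "q \<cdot> c = p \<cdot> pB"
    using is_cokernelD(2)[OF c \<alpha> c' ppB] by blast
  have q_epi: "is_epi C q"
    unfolding is_epi_def
  proof (intro conjI ballI impI)
    show "q \<in> Arr C" using HomD[OF q(1)] by simp
    fix W g h assume "W \<in> Ob C" "g \<in> Hom C (Cod C q) W" "h \<in> Hom C (Cod C q) W" and eq: "g \<cdot> q = h \<cdot> q"
    then have g: "g \<in> Hom C X W" and h: "h \<in> Hom C X W" using HomD[OF q(1)] by simp_all
    \<comment> \<open>Restricting \<open>k \<cdot> q\<close> along \<open>c \<cdot> iB\<close>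
      recovers \<open>k \<cdot> p\<close>, so \<open>q\<close> inherits being epic from
      \<open>p\<close>.\<close>
    have "k \<cdot> p = ((k \<cdot> q) \<cdot> c) \<cdot> iB" if k: "k \<in> Hom C X W" for k
    proof -
      have "((k \<cdot> q) \<cdot> c) \<cdot> iB = (k \<cdot> (p \<cdot> pB)) \<cdot> iB" using Comp_assoc[OF c' q(1) k] q(2) by simp
      also have "\<dots> = k \<cdot> p"
        using Comp_assoc[OF iB ppB k] Comp_assoc[OF iB pB p(1)] pi(1) Comp_Ident_right[OF p(1)] by simp
      finally show ?thesis by simp
    qed
    then have "g \<cdot> p = h \<cdot> p" using g h eq by simp
    then show "g = h" using is_epiD[OF p(2,1) g h] by blast
  qed
  have "is_cokernel C (c \<cdot> iD) q"
  proof (rule is_cokernelI[OF j q(1) q_epi])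
    show "q \<cdot> (c \<cdot> iD) = Zero C D X"
      using Comp_assoc[OF iD c' q(1)] q(2) Comp_assoc[OF iD pB p(1)] pi(3)
        Comp_Zero_right[OF p(1) Ob(6)] by simp
    fix W z assume z: "z \<in> Hom C E W" "z \<cdot> (c \<cdot> iD) = Zero C D W"
    note W = Hom_Ob(2)[OF z(1)] and zc = Comp_in_Hom[OF c' z(1)] and zcB = Comp_in_Hom[OF cB z(1)]
    have "(z \<cdot> (c \<cdot> iB)) \<cdot> i = Zero C A W"
      using Comp_assoc[OF i(1) cB z(1)] square Comp_assoc[OF f j z(1)] z(2) Comp_Zero_left[OF f W] by simp
    then obtain w where w: "w \<in> Hom C X W" "w \<cdot> p = z \<cdot> (c \<cdot> iB)"
      using is_cokernelD(2)[OF cok i(1) p(1) zcB] by blast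
    \<comment> \<open>Expand the identity of the biproduct: the \<open>D\<close> summand vanishes by
      assumption on \<open>z\<close>, and the \<open>B\<close> summand is
      \<open>(w \<cdot> q) \<cdot> c\<close>. As \<open>c\<close> is epic, \<open>w\<close> factors
      \<open>z\<close> through \<open>q\<close>.\<close>
    have "z \<cdot> c = (z \<cdot> c) \<cdot> Add C (iB \<cdot> pB) (iD \<cdot> pD)"
      using sum Comp_Ident_right[OF zc] by simp
    also have "\<dots> = Add C ((z \<cdot> c) \<cdot> (iB \<cdot> pB)) ((z \<cdot> c) \<cdot> (iD \<cdot> pD))"
      by (rule Comp_Add_right[OF Comp_in_Hom[OF pB iB] Comp_in_Hom[OF pD iD] zc])
    also have "(z \<cdot> c) \<cdot> (iD \<cdot> pD) = Zero C P W"
      using Comp_assoc[OF pD iD zc] Comp_assoc[OF iD c' z(1)] z(2) Comp_Zero_left[OF pD W] by simp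
    also have "(z \<cdot> c) \<cdot> (iB \<cdot> pB) = (w \<cdot> q) \<cdot> c"
      using Comp_assoc[OF pB iB zc] Comp_assoc[OF iB c' z(1)] w(2) Comp_assoc[OF pB p(1) w(1)]
        Comp_assoc[OF c' q(1) w(1)] q(2) by simp
    also have "Add C ((w \<cdot> q) \<cdot> c) (Zero C P W) = (w \<cdot> q) \<cdot> c"
      by (rule Add_Zero_right[OF Comp_in_Hom[OF c' Comp_in_Hom[OF q(1) w(1)]]])
    finally have "w \<cdot> q = z"
      using is_epiD[OF c_epi c' z(1) Comp_in_Hom[OF q(1) w(1)]] by simp
    then show "\<exists>u \<in> Hom C X W. u \<cdot> q = z" using w(1) by blast
  qed
  then show ?thesis using short_exactI[OF j q(1) j_mono] cB square by blast
qed

text \<open>Push the sequence out along \<open>f\<close>. The result is an extension of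
  \<open>X\<close> by \<open>D\<close>, which splits; its retraction after the comparison arrow
  \<open>h\<close> extends \<open>f\<close>.\<close>

lemma Ext1_vanishes_extend:
  assumes s: "short_exact C A B X i p" and f: "f \<in> Hom C A D" and ext: "Ext1_vanishes C X D"
  shows "\<exists>g \<in> Hom C B D. g \<cdot> i = f"
proof -
  obtain E j q h where E: "short_exact C D E X j q" and h: "h \<in> Hom C B E" "h \<cdot> i = j \<cdot> f"
    using short_exact_pushout[OF s f] by blast
  obtain r where r: "r \<in> Hom C E D" "r \<cdot> j = Ident C D"
    using Ext1_vanishes_retraction[OF ext E] by blast
  have i: "i \<in> Hom C A B" and j: "j \<in> Hom C D E" using s E by (auto simp: short_exact_def)
  have "(r \<cdot> h) \<cdot> i = f"
    using Comp_assoc[OF i h(1) r(1)] h(2) Comp_assoc[OF f j r(1)] r(2) Comp_Ident_left[OF f] by simp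
  then show ?thesis using Comp_in_Hom[OF h(1) r(1)] by blast
qed

end

section \<open>Quotients by a factorization congruence\<close>

text \<open>The congruence property is an assumption, so that the structure on classes is separated
  from its verification, which for \<D> modulo \<F> \<inter> \<D> rests on torsion parts.\<close>

locale factor_congruence = category E
  for E :: "('o, 'm, 'x) preadditive_data_scheme" (structure) and \<X> :: "'o set" +
  assumes equiv_factor_rel: "equiv (Arr E) (factor_rel E \<X>)"
    and Comp_factor_rel: "f \<in> Hom E A B \<Longrightarrow> g \<in> Hom E B D \<Longrightarrow>
      (f, f') \<in> factor_rel E \<X> \<Longrightarrow> (g, g') \<in> factor_rel E \<X> \<Longrightarrow>
      (g \<cdot> f, g' \<cdot> f') \<in> factor_rel E \<X>"
begin

abbreviation "cls f \<equiv> factor_rel E \<X> `` {f}"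

abbreviation "Q \<equiv> quotient_category E \<X>"

lemma cls_subset_Hom: "f \<in> Hom E A B \<Longrightarrow> cls f \<subseteq> Hom E A B"
  by (auto simp: factor_rel_def Hom_def)

lemma cls_self: "f \<in> Hom E A B \<Longrightarrow> f \<in> cls f"
  using equiv_factor_rel by (auto simp: equiv_def refl_on_def Hom_def)

lemma Hom_quotient_category: "Hom Q A B = (\<lambda>f. cls f) ` Hom E A B"
proof -
  have dc: "Dom Q (cls f) = Dom E f \<and> Cod Q (cls f) = Cod E f" if "f \<in> Arr E" for f
  proof -
    have "Dom E ` cls f = {Dom E f}" "Cod E ` cls f = {Cod E f}"
      using cls_subset_Hom[OF Arr_in_Hom[OF that]] cls_self[OF Arr_in_Hom[OF that]]
      by (auto simp: Hom_def image_iff)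
    then show ?thesis by (simp add: quotient_category_def)
  qed
  have "Arr Q = (\<lambda>f. cls f) ` Arr E"
    by (auto simp: quotient_category_def quotient_def)
  then show ?thesis unfolding Hom_def using dc by (auto simp: image_iff)
qed

text \<open>By the congruence property all composites of representatives are related to
  \<open>g \<cdot> f\<close>, so the union of classes that defines the composite is a single
  class.\<close>

lemma Comp_quotient_category:
  assumes f: "f \<in> Hom E A B" and g: "g \<in> Hom E B D"
  shows "cls g \<cdot>\<^bsub>Q\<^esub> cls f = cls (g \<cdot> f)"
proof -
  have "cls (g' \<cdot> f') = cls (g \<cdot> f)" if "g' \<in> cls g" "f' \<in> cls f" for g' f'
    using Comp_factor_rel[OF f g, of f' g'] that equiv_class_eq[OF equiv_factor_rel] by auto
  then have "factor_rel E \<X> `` {g' \<cdot> f' | g' f'. g' \<in> cls g \<and> f' \<in> cls f} = cls (g \<cdot> f)"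
    using cls_self[OF f] cls_self[OF g] by blast
  then show ?thesis by (simp add: quotient_category_def)
qed

lemma category_quotient_category: "category Q"
proof
  have [simp]: "Ob Q = Ob E" "Ident Q A = cls (Ident E A)" for A
    by (simp_all add: quotient_category_def)
  show "Dom Q K \<in> Ob Q" "Cod Q K \<in> Ob Q" if "K \<in> Arr Q" for K
    using Arr_in_Hom[OF that] Hom_Ob by (auto simp: Hom_quotient_category)
  show "Ident Q A \<in> Hom Q A A" if "A \<in> Ob Q" for A
    using that Ident_in_Hom by (auto simp: Hom_quotient_category)
  show "L \<cdot>\<^bsub>Q\<^esub> K \<in> Hom Q A D" if "K \<in> Hom Q A B" "L \<in> Hom Q B D" for K L A B D
    using that Comp_in_Hom by (auto simp: Hom_quotient_category Comp_quotient_category)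
  show "K \<cdot>\<^bsub>Q\<^esub> Ident Q A = K" "Ident Q B \<cdot>\<^bsub>Q\<^esub> K = K" if K: "K \<in> Hom Q A B" for K A B
  proof -
    obtain f where f: "f \<in> Hom E A B" "K = cls f" using K by (auto simp: Hom_quotient_category)
    note I = Ident_in_Hom[OF Hom_Ob(1)[OF f(1)]] Ident_in_Hom[OF Hom_Ob(2)[OF f(1)]]
    show "K \<cdot>\<^bsub>Q\<^esub> Ident Q A = K" "Ident Q B \<cdot>\<^bsub>Q\<^esub> K = K"
      using Comp_quotient_category[OF I(1) f(1)] Comp_quotient_category[OF f(1) I(2)] f(2)
        Comp_Ident_left[OF f(1)] Comp_Ident_right[OF f(1)] by simp_all
  qed
  show "(M \<cdot>\<^bsub>Q\<^esub> L) \<cdot>\<^bsub>Q\<^esub> K = M \<cdot>\<^bsub>Q\<^esub> (L \<cdot>\<^bsub>Q\<^esub> K)"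
    if K: "K \<in> Hom Q A B" and L: "L \<in> Hom Q B D" and M: "M \<in> Hom Q D G" for K L M A B D G
  proof -
    obtain f g h where f: "f \<in> Hom E A B" "K = cls f" and g: "g \<in> Hom E B D" "L = cls g"
      and h: "h \<in> Hom E D G" "M = cls h" using K L M by (auto simp: Hom_quotient_category)
    show ?thesis
      using Comp_quotient_category[OF f(1) g(1)] Comp_quotient_category[OF g(1) h(1)]
        Comp_quotient_category[OF Comp_in_Hom[OF f(1) g(1)] h(1)]
        Comp_quotient_category[OF f(1) Comp_in_Hom[OF g(1) h(1)]]
        Comp_assoc[OF f(1) g(1) h(1)] f(2) g(2) h(2) by simp
  qed
qed

end

section \<open>Torsion-cotorsion triples\<close>

locale torsion_cotorsion_triple = abelian_category +
  fixes \<T> \<F> \<D> :: "'a set"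
  assumes torsion: "torsion_pair C \<T> \<F>" and cotorsion: "cotorsion_pair C \<F> \<D>"
begin

lemma subset_Ob: "\<T> \<subseteq> Ob C" "\<F> \<subseteq> Ob C" "\<D> \<subseteq> Ob C"
  using torsion cotorsion unfolding torsion_pair_def cotorsion_pair_def is_full_subcategory_def
  by blast+

lemma Hom_torsion: "f \<in> Hom C T F \<Longrightarrow> T \<in> \<T> \<Longrightarrow> F \<in> \<F> \<Longrightarrow> f = Zero C T F"
  using torsion unfolding torsion_pair_def by blast

lemma Ext1_vanishes_\<F>_\<D>: "F \<in> \<F> \<Longrightarrow> D \<in> \<D> \<Longrightarrow> Ext1_vanishes C F D"
  using cotorsion unfolding cotorsion_pair_def right_perp1_def by blast

text \<open>The torsion part \<open>k\<close> of \<open>E\<close> vanishes: its composite into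
  \<open>F'\<close> is zero, so it lifts to \<open>F\<close>, where the lift is zero as well. Hence
  \<open>E\<close> is isomorphic to its torsion-free quotient.\<close>

lemma extension_closed:
  assumes s: "short_exact C F E F' i p" and "F \<in> \<F>" "F' \<in> \<F>"
  shows "E \<in> \<F>"
proof -
  have i: "i \<in> Hom C F E" and p: "p \<in> Hom C E F'" using s by (auto simp: short_exact_def)
  note E = Hom_Ob(2)[OF i]
  obtain t f k q where t: "t \<in> \<T>" and f: "f \<in> \<F>" and kq: "short_exact C t E f k q"
    using torsion E unfolding torsion_pair_def by blast
  have k: "k \<in> Hom C t E" and q: "q \<in> Hom C E f" "is_epi C q" using kq by (auto simp: short_exact_def)
  have "p \<cdot> k = Zero C t F'" using Hom_torsion[OF Comp_in_Hom[OF k p]] t assms by blast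
  then obtain v where v: "v \<in> Hom C t F" "i \<cdot> v = k"
    using is_kernelD(2)[OF short_exact_is_kernel[OF s] p i k] by blast
  have "k = Zero C t E"
    using v Hom_torsion[OF v(1)] t assms Comp_Zero_right[OF i Hom_Ob(1)[OF v(1)]] by simp
  then have "Ident C E \<cdot> k = Zero C t E" using Comp_Ident_left[OF k] by simp
  then obtain r where r: "r \<in> Hom C f E" "r \<cdot> q = Ident C E"
    using is_cokernelD(2)[OF short_exact_is_cokernel[OF kq] k q(1) Ident_in_Hom[OF E]] by blast
  \<comment> \<open>\<open>r\<close> is a left inverse of the epimorphism \<open>q\<close>, so
    cancelling \<open>q\<close> shows that it is also a right inverse.\<close>
  have "(q \<cdot> r) \<cdot> q = Ident C f \<cdot> q"
    using Comp_assoc[OF q(1) r(1) q(1)] r(2) Comp_Ident_right[OF q(1)] Comp_Ident_left[OF q(1)] by simp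
  then have "q \<cdot> r = Ident C f"
    using is_epiD[OF q(2,1) Comp_in_Hom[OF r(1) q(1)] Ident_in_Hom[OF Hom_Ob(1)[OF r(1)]]] by blast
  then have "is_iso C r" using is_isoI[OF r(1) q(1)] r(2) by blast
  then show ?thesis
    using torsion f HomD[OF r(1)] unfolding torsion_pair_def is_full_subcategory_def by metis
qed

text \<open>A relation rather than a chosen subobject, so that it covers both the torsion sequence
  of a given object and the embedding of an object of \<T> into one of \<D>.\<close>

definition torsion_part :: "'a \<Rightarrow> 'a \<Rightarrow> 'b \<Rightarrow> bool" where
  "torsion_part T X i \<longleftrightarrow> T \<in> \<T> \<and> (\<exists>F \<in> \<F>. \<exists>p. short_exact C T X F i p)"

lemma torsion_partD:
  assumes "torsion_part T X i"
  shows "T \<in> \<T>" "i \<in> Hom C T X" "is_mono C i"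
  using assms by (auto simp: torsion_part_def short_exact_def)

lemma ex_torsion_part: "X \<in> Ob C \<Longrightarrow> \<exists>T i. torsion_part T X i"
  using torsion unfolding torsion_pair_def torsion_part_def by blast

text \<open>The sequence of the cotorsion pair that starts at \<open>T\<close> has its third term in
  \<F>, which makes it a torsion sequence of its middle term.\<close>

lemma ex_torsion_part_of: "T \<in> \<T> \<Longrightarrow> \<exists>X \<in> \<D>. \<exists>i. torsion_part T X i"
  using cotorsion subset_Ob(1) unfolding cotorsion_pair_def torsion_part_def by blast

text \<open>Following \<open>h\<close> by the quotient map gives an arrow from \<T> to \<F>, hence
  zero; so \<open>h\<close> factors through the kernel \<open>i\<close>.\<close>

lemma torsion_part_lift:
  assumes "torsion_part T X i" "S \<in> \<T>" "h \<in> Hom C S X"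
  shows "\<exists>u \<in> Hom C S T. i \<cdot> u = h"
proof -
  obtain F p where F: "F \<in> \<F>" and s: "short_exact C T X F i p"
    using assms(1) by (auto simp: torsion_part_def)
  have i: "i \<in> Hom C T X" and p: "p \<in> Hom C X F" using s by (auto simp: short_exact_def)
  show ?thesis
    using is_kernelD(2)[OF short_exact_is_kernel[OF s] p i assms(3)]
      Hom_torsion[OF Comp_in_Hom[OF assms(3) p] assms(2) F] by blast
qed

text \<open>The cokernel of \<open>i\<close> lies in \<F> and has no nontrivial extensions by
  objects of \<D>.\<close>

lemma torsion_part_extend:
  assumes "torsion_part T X i" "Y \<in> \<D>" "h \<in> Hom C T Y"
  shows "\<exists>g \<in> Hom C X Y. g \<cdot> i = h"
  using assms Ext1_vanishes_extend Ext1_vanishes_\<F>_\<D> unfolding torsion_part_def by blast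

text \<open>An arrow through \<F> restricts to zero on \<open>T\<close> because Hom from \<T> to
  \<F> vanishes; the converse builds the factorization from the torsion-free quotient of
  \<open>X\<close>.\<close>

lemma factors_through_iff:
  assumes i: "torsion_part T X i" and Y: "Y \<in> \<D>" and g: "g \<in> Hom C X Y"
  shows "factors_through C (\<F> \<inter> \<D>) g \<longleftrightarrow> g \<cdot> i = Zero C T Y"
proof
  note i' = torsion_partD(2)[OF i] and Y' = Hom_Ob(2)[OF g]
  assume "factors_through C (\<F> \<inter> \<D>) g"
  then obtain Z u v where Z: "Z \<in> \<F>" and u: "u \<in> Hom C X Z" and v: "v \<in> Hom C Z Y" and eq: "g = v \<cdot> u"
    unfolding factors_through_def using HomD[OF g] by auto
  show "g \<cdot> i = Zero C T Y"
    using Comp_assoc[OF i' u v] Hom_torsion[OF Comp_in_Hom[OF i' u] torsion_partD(1)[OF i] Z]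
      Comp_Zero_right[OF v Hom_Ob(1)[OF i']] eq by simp
next
  assume 0: "g \<cdot> i = Zero C T Y"
  obtain F p where F: "F \<in> \<F>" and s: "short_exact C T X F i p"
    using i by (auto simp: torsion_part_def)
  have i': "i \<in> Hom C T X" and p: "p \<in> Hom C X F" using s by (auto simp: short_exact_def)
  obtain h where h: "h \<in> Hom C F Y" "h \<cdot> p = g"
    using is_cokernelD(2)[OF short_exact_is_cokernel[OF s] i' p g 0] by blast
  obtain F' Z j q where F': "F' \<in> \<F>" and Z: "Z \<in> \<D>" and s': "short_exact C F Z F' j q"
    using cotorsion subset_Ob(2) F unfolding cotorsion_pair_def by blast
  \<comment> \<open>\<open>Z\<close> lies in \<D> by choice and in \<F> as an extension of
    \<open>F'\<close> by \<open>F\<close>.\<close>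
  have "Z \<in> \<F>" using extension_closed[OF s' F F'] .
  moreover obtain k where k: "k \<in> Hom C Z Y" "k \<cdot> j = h"
    using Ext1_vanishes_extend[OF s' h(1) Ext1_vanishes_\<F>_\<D>[OF F' Y]] by blast
  have j: "j \<in> Hom C F Z" using s' by (auto simp: short_exact_def)
  have "g = k \<cdot> (j \<cdot> p)" using Comp_assoc[OF p j k(1)] k(2) h(2) by simp
  ultimately show "factors_through C (\<F> \<inter> \<D>) g"
    using Z k(1) Comp_in_Hom[OF p j] HomD[OF g] unfolding factors_through_def by blast
qed

section \<open>The congruence on \<D> read off from torsion parts\<close>

abbreviation "\<E> \<equiv> full_subcategory C \<D>"

lemma factor_rel_iff:
  assumes i: "torsion_part T X i" and X: "X \<in> \<D>" and Y: "Y \<in> \<D>" and f: "f \<in> Hom C X Y"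
  shows "(f, g) \<in> factor_rel \<E> (\<F> \<inter> \<D>) \<longleftrightarrow> g \<in> Hom C X Y \<and> g \<cdot> i = f \<cdot> i"
proof -
  have "factors_through \<E> (\<F> \<inter> \<D>) (Diff \<E> f g) \<longleftrightarrow> g \<cdot> i = f \<cdot> i" if g: "g \<in> Hom C X Y"
  proof -
    \<comment> \<open>Fullness transfers both ingredients to the ambient category: differences are
      formed in the same Hom-group, and factorizations through objects of \<F> \<inter> \<D> are the
      same.\<close>
    have "hom_group \<E> X Y = hom_group C X Y"
      using X Y by (simp add: hom_group_def Hom_full_subcategory) (simp add: full_subcategory_def)
    then have "Diff \<E> f g = Diff C f g"
      using HomD[OF g] by (simp add: Diff_def) (simp add: full_subcategory_def)
    moreover have "factors_through \<E> (\<F> \<inter> \<D>) d \<longleftrightarrow> factors_through C (\<F> \<inter> \<D>) d"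
      if "d \<in> Hom C X Y" for d
      using X Y HomD[OF that] unfolding factors_through_def
      by (simp add: Hom_full_subcategory cong: bex_cong_simp)
    ultimately show ?thesis
      using factors_through_iff[OF i Y] Diff_in_Hom[OF f g]
        Comp_Diff_left_eq_Zero_iff[OF f g torsion_partD(2)[OF i]] by auto
  qed
  moreover have "f \<in> Arr \<E>" "Hom \<E> (Dom \<E> f) (Cod \<E> f) = Hom C X Y"
    using HomD[OF f] X Y Hom_full_subcategory by (auto simp: full_subcategory_def)
  ultimately show ?thesis unfolding factor_rel_def by auto
qed

text \<open>Being an equivalence is inherited from equality of restrictions to the torsion part. For
  composition, \<open>f \<cdot> i\<close> lifts to the torsion part of \<open>Y\<close>, on which
  \<open>g\<close> and \<open>g'\<close> agree.\<close>

lemma factor_congruence: "factor_congruence \<E> (\<F> \<inter> \<D>)"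
proof -
  let ?R = "factor_rel \<E> (\<F> \<inter> \<D>)"
  interpret E: category \<E> using category_full_subcategory subset_Ob(3) .
  \<comment> \<open>A single torsion part of \<open>X\<close> describes the relation on all arrows
    from \<open>X\<close> into \<D>, so related arrows are always compared on the same
    \<open>i\<close>.\<close>
  have R: "\<exists>T i. torsion_part T X i \<and> (\<forall>Y \<in> \<D>. \<forall>f \<in> Hom C X Y. \<forall>g.
      (f, g) \<in> ?R \<longleftrightarrow> g \<in> Hom C X Y \<and> g \<cdot> i = f \<cdot> i)" if "X \<in> \<D>" for X
    using ex_torsion_part[of X] that subset_Ob(3) factor_rel_iff by blast
  show ?thesis
  proof
    have sub: "?R \<subseteq> Arr \<E> \<times> Arr \<E>" by (auto simp: factor_rel_def Hom_def)
    have Arr: "\<exists>X \<in> \<D>. \<exists>Y \<in> \<D>. f \<in> Hom C X Y" if "f \<in> Arr \<E>" for f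
      using that by (auto simp: full_subcategory_def Hom_def)
    have "(f, f) \<in> ?R" if "f \<in> Arr \<E>" for f
      using Arr[OF that] R by blast
    then have "refl_on (Arr \<E>) ?R" unfolding refl_on_def by blast
    moreover have "sym ?R"
    proof (rule symI)
      fix f g assume fg: "(f, g) \<in> ?R"
      obtain X Y where XY: "X \<in> \<D>" "Y \<in> \<D>" "f \<in> Hom C X Y" using sub fg Arr by blast
      then show "(g, f) \<in> ?R" using R[OF XY(1)] fg by (metis (no_types, lifting))
    qed
    moreover have "trans ?R"
    proof (rule transI)
      fix f g h assume fg: "(f, g) \<in> ?R" "(g, h) \<in> ?R"
      obtain X Y where XY: "X \<in> \<D>" "Y \<in> \<D>" "f \<in> Hom C X Y" using sub fg Arr by blast
      then show "(f, h) \<in> ?R" using R[OF XY(1)] fg by (metis (no_types, lifting))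
    qed
    ultimately show "equiv (Arr \<E>) ?R" using sub by (simp add: equiv_def)
    fix f f' g g' X Y Z
    assume "f \<in> Hom \<E> X Y" "g \<in> Hom \<E> Y Z" and ff': "(f, f') \<in> ?R" and gg': "(g, g') \<in> ?R"
    then have f: "f \<in> Hom C X Y" and g: "g \<in> Hom C Y Z" and X: "X \<in> \<D>" and Y: "Y \<in> \<D>" and Z: "Z \<in> \<D>"
      using Hom_full_subcategoryD by blast+
    obtain T i where i: "torsion_part T X i" using ex_torsion_part X subset_Ob(3) by blast
    obtain S j where j: "torsion_part S Y j" using ex_torsion_part Y subset_Ob(3) by blast
    note i' = torsion_partD(2)[OF i] and j' = torsion_partD(2)[OF j]
    have f': "f' \<in> Hom C X Y" "f' \<cdot> i = f \<cdot> i" using factor_rel_iff[OF i X Y f] ff' by auto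
    have g': "g' \<in> Hom C Y Z" "g' \<cdot> j = g \<cdot> j" using factor_rel_iff[OF j Y Z g] gg' by auto
    obtain u where u: "u \<in> Hom C T S" "j \<cdot> u = f \<cdot> i"
      using torsion_part_lift[OF j torsion_partD(1)[OF i] Comp_in_Hom[OF i' f]] by blast
    have "(g' \<cdot> f') \<cdot> i = (g \<cdot> f) \<cdot> i"
      using Comp_assoc[OF i' f g] f'(2) Comp_assoc[OF i' f'(1) g'(1)] u(2)
        Comp_assoc[OF u(1) j' g] Comp_assoc[OF u(1) j' g'(1)] g'(2) by simp
    then show "(g \<cdot>\<^bsub>\<E>\<^esub> f, g' \<cdot>\<^bsub>\<E>\<^esub> f') \<in> ?R"
      using factor_rel_iff[OF i X Z Comp_in_Hom[OF f g]] Comp_in_Hom[OF f'(1) g'(1)] by simp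
  qed
qed

section \<open>Construction of the equivalence\<close>

theorem equivalent_categories_torsion_quotient:
  "equivalent_categories (full_subcategory C \<T>) (quotient_category \<E> (\<F> \<inter> \<D>))"
proof -
  interpret Q: factor_congruence \<E> "\<F> \<inter> \<D>" using factor_congruence .
  interpret T: category "full_subcategory C \<T>" using category_full_subcategory subset_Ob(1) .
  interpret QC: category Q.Q using Q.category_quotient_category .
  have [simp]: "Ob Q.Q = \<D>" "Ident Q.Q X = Q.cls (Ident C X)" for X
    by (simp_all add: quotient_category_def)
  obtain V j where V: "\<And>T. T \<in> \<T> \<Longrightarrow> V T \<in> \<D>" and j: "\<And>T. T \<in> \<T> \<Longrightarrow> torsion_part T (V T) (j T)"
    using ex_torsion_part_of by metis
  \<comment> \<open>The value is the whole set of extensions, so no representative has to be chosen;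
    \<open>\<Phi>_cls\<close> identifies it as a congruence class.\<close>
  define \<Phi> where "\<Phi> f = {g \<in> Hom C (V (Dom C f)) (V (Cod C f)). g \<cdot> j (Dom C f) = j (Cod C f) \<cdot> f}" for f
  have cls: "Q.cls g = {h \<in> Hom C X Y. h \<cdot> i = g \<cdot> i}"
    if "torsion_part T X i" "X \<in> \<D>" "Y \<in> \<D>" "g \<in> Hom C X Y" for T X Y i g
    using factor_rel_iff[OF that] by auto
  \<comment> \<open>Arrows congruent to \<open>g\<close> are those with the same restriction along
    \<open>j S\<close>, so any one extension represents \<open>\<Phi> f\<close>.\<close>
  have \<Phi>_cls: "\<Phi> f = Q.cls g"
    if "S \<in> \<T>" "T \<in> \<T>" "f \<in> Hom C S T" "g \<in> Hom C (V S) (V T)" "g \<cdot> j S = j T \<cdot> f" for S T f g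
    using cls[OF j[OF that(1)] V[OF that(1)] V[OF that(2)] that(4)] that(5) HomD[OF that(3)]
    by (simp add: \<Phi>_def)
  have lift: "\<exists>g \<in> Hom C (V S) (V T). g \<cdot> j S = j T \<cdot> f"
    if "S \<in> \<T>" "T \<in> \<T>" "f \<in> Hom C S T" for S T f
    using torsion_part_extend[OF j V Comp_in_Hom[OF that(3)]] torsion_partD(2)[OF j] that by blast
  have HomQ: "Hom Q.Q X Y = (\<lambda>f. Q.cls f) ` Hom C X Y" if "X \<in> \<D>" "Y \<in> \<D>" for X Y
    using Q.Hom_quotient_category Hom_full_subcategory[OF that] by simp
  have \<Phi>_Hom: "\<Phi> f \<in> Hom Q.Q (V S) (V T)" if S: "S \<in> \<T>" and T: "T \<in> \<T>" and f: "f \<in> Hom C S T" for S T f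
  proof -
    obtain g where g: "g \<in> Hom C (V S) (V T)" "g \<cdot> j S = j T \<cdot> f" using lift[OF S T f] by blast
    show ?thesis using \<Phi>_cls[OF S T f g] HomQ[OF V[OF S] V[OF T]] g(1) by simp
  qed
  have CompQ: "Q.cls g \<cdot>\<^bsub>Q.Q\<^esub> Q.cls f = Q.cls (g \<cdot> f)"
    if "f \<in> Hom C X Y" "g \<in> Hom C Y Z" "X \<in> \<D>" "Y \<in> \<D>" "Z \<in> \<D>" for f g X Y Z
    using Q.Comp_quotient_category[of f X Y g Z] that by (simp add: Hom_full_subcategory)
  show ?thesis
  proof (rule equivalent_categories_if_fully_faithful)
    show "category_functor (full_subcategory C \<T>) Q.Q V \<Phi>"
    proof
      show "V S \<in> Ob Q.Q" if "S \<in> Ob (full_subcategory C \<T>)" for S using that V by simp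
      show "\<Phi> f \<in> Hom Q.Q (V S) (V T)" if "f \<in> Hom (full_subcategory C \<T>) S T" for f S T
        using Hom_full_subcategoryD[OF that] \<Phi>_Hom by simp
      show "\<Phi> (Ident (full_subcategory C \<T>) S) = Ident Q.Q (V S)" if "S \<in> Ob (full_subcategory C \<T>)" for S
      proof -
        have S: "S \<in> \<T>" "S \<in> Ob C" "V S \<in> Ob C" using that subset_Ob V by auto
        note jS = torsion_partD(2)[OF j[OF S(1)]]
        show ?thesis
          using \<Phi>_cls[OF S(1) S(1) Ident_in_Hom[OF S(2)] Ident_in_Hom[OF S(3)]]
            Comp_Ident_left[OF jS] Comp_Ident_right[OF jS] by simp
      qed
      show "\<Phi> (g \<cdot>\<^bsub>full_subcategory C \<T>\<^esub> f) = \<Phi> g \<cdot>\<^bsub>Q.Q\<^esub> \<Phi> f"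
        if "f \<in> Hom (full_subcategory C \<T>) R S" "g \<in> Hom (full_subcategory C \<T>) S T" for f g R S T
      proof -
        have R: "R \<in> \<T>" and S: "S \<in> \<T>" and T: "T \<in> \<T>"
          and f: "f \<in> Hom C R S" and g: "g \<in> Hom C S T"
          using Hom_full_subcategoryD that by blast+
        obtain f' where f': "f' \<in> Hom C (V R) (V S)" "f' \<cdot> j R = j S \<cdot> f" using lift[OF R S f] by blast
        obtain g' where g': "g' \<in> Hom C (V S) (V T)" "g' \<cdot> j S = j T \<cdot> g" using lift[OF S T g] by blast
        note jR = torsion_partD(2)[OF j[OF R]] and jS = torsion_partD(2)[OF j[OF S]]
          and jT = torsion_partD(2)[OF j[OF T]]
        \<comment> \<open>A composite of extensions extends the composite.\<close>
        have "(g' \<cdot> f') \<cdot> j R = j T \<cdot> (g \<cdot> f)"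
          using Comp_assoc[OF jR f'(1) g'(1)] f'(2) Comp_assoc[OF f jS g'(1)] g'(2)
            Comp_assoc[OF f g jT] by simp
        then show ?thesis
          using \<Phi>_cls[OF R S f f'] \<Phi>_cls[OF S T g g']
            \<Phi>_cls[OF R T Comp_in_Hom[OF f g] Comp_in_Hom[OF f'(1) g'(1)]]
            CompQ[OF f'(1) g'(1) V[OF R] V[OF S] V[OF T]] by simp
      qed
    qed
  next
    fix S T assume "S \<in> Ob (full_subcategory C \<T>)" "T \<in> Ob (full_subcategory C \<T>)"
    then have S: "S \<in> \<T>" and T: "T \<in> \<T>" by simp_all
    note jS = torsion_partD(2)[OF j[OF S]] and jT = torsion_partD(2,3)[OF j[OF T]]
    have "inj_on \<Phi> (Hom C S T)"
    proof (rule inj_onI)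
      fix f g assume f: "f \<in> Hom C S T" and g: "g \<in> Hom C S T" and eq: "\<Phi> f = \<Phi> g"
      \<comment> \<open>An arrow \<open>h\<close> in the common class determines both
        \<open>j T \<cdot> f\<close> and \<open>j T \<cdot> g\<close>, and \<open>j T\<close> is
        monic.\<close>
      obtain h where h: "h \<in> \<Phi> f" using lift[OF S T f] HomD[OF f] by (auto simp: \<Phi>_def)
      have "h \<cdot> j S = j T \<cdot> f" using h HomD[OF f] by (simp add: \<Phi>_def)
      moreover have "h \<cdot> j S = j T \<cdot> g" using h[unfolded eq] HomD[OF g] by (simp add: \<Phi>_def)
      ultimately have "j T \<cdot> f = j T \<cdot> g" by simp
      then show "f = g" using is_monoD[OF jT(2,1) f g] by blast
    qed
    moreover have "\<Phi> ` Hom C S T = Hom Q.Q (V S) (V T)"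
    proof
      show "\<Phi> ` Hom C S T \<subseteq> Hom Q.Q (V S) (V T)"
        using \<Phi>_Hom[OF S T] by (rule image_subsetI)
      show "Hom Q.Q (V S) (V T) \<subseteq> \<Phi> ` Hom C S T"
      proof
        fix K assume "K \<in> Hom Q.Q (V S) (V T)"
        then obtain g where g: "g \<in> Hom C (V S) (V T)" "K = Q.cls g" using HomQ V S T by auto
        \<comment> \<open>The restriction \<open>g \<cdot> j S\<close> starts in \<T>, so it lifts
          to \<open>T\<close>, the torsion part of \<open>V T\<close>; the lift is the preimage of
          the class of \<open>g\<close>.\<close>
        obtain f where f: "f \<in> Hom C S T" "j T \<cdot> f = g \<cdot> j S"
          using torsion_part_lift[OF j[OF T] S Comp_in_Hom[OF jS g(1)]] by blast
        show "K \<in> \<Phi> ` Hom C S T" using \<Phi>_cls[OF S T f(1) g(1)] f g(2) by auto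
      qed
    qed
    ultimately show "bij_betw \<Phi> (Hom (full_subcategory C \<T>) S T) (Hom Q.Q (V S) (V T))"
      using Hom_full_subcategory[OF S T] by (simp add: bij_betw_def)
  next
    fix Y assume "Y \<in> Ob Q.Q"
    then have Y: "Y \<in> \<D>" by simp
    obtain T i where i: "torsion_part T Y i" using ex_torsion_part Y subset_Ob(3) by blast
    note T = torsion_partD(1)[OF i] and i' = torsion_partD(2)[OF i]
    note jT = j[OF T] and j' = torsion_partD(2)[OF j[OF T]] and VT = V[OF T]
    \<comment> \<open>Both \<open>Y\<close> and \<open>V T\<close> have torsion part
      \<open>T\<close>. Extending each inclusion along the other gives \<open>g\<close> and
      \<open>h\<close>; each composite agrees with the identity on the torsion part, so their
      classes are mutually inverse.\<close>
    obtain g where g: "g \<in> Hom C (V T) Y" "g \<cdot> j T = i" using torsion_part_extend[OF jT Y i'] by blast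
    obtain h where h: "h \<in> Hom C Y (V T)" "h \<cdot> i = j T" using torsion_part_extend[OF i VT j'] by blast
    note VT_Ob = Hom_Ob(1)[OF g(1)] and Y_Ob = Hom_Ob(2)[OF g(1)]
    have "(h \<cdot> g) \<cdot> j T = Ident C (V T) \<cdot> j T"
      using Comp_assoc[OF j' g(1) h(1)] g(2) h(2) Comp_Ident_left[OF j'] by simp
    then have "Q.cls (h \<cdot> g) = Q.cls (Ident C (V T))"
      using cls[OF jT VT VT] Comp_in_Hom[OF g(1) h(1)] Ident_in_Hom[OF VT_Ob] by simp
    moreover have "(g \<cdot> h) \<cdot> i = Ident C Y \<cdot> i"
      using Comp_assoc[OF i' h(1) g(1)] g(2) h(2) Comp_Ident_left[OF i'] by simp
    then have "Q.cls (g \<cdot> h) = Q.cls (Ident C Y)"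
      using cls[OF i Y Y] Comp_in_Hom[OF h(1) g(1)] Ident_in_Hom[OF Y_Ob] by simp
    ultimately have "is_iso Q.Q (Q.cls g)"
      using is_isoI[of "Q.cls g" Q.Q "V T" Y "Q.cls h"] HomQ[OF VT Y] HomQ[OF Y VT] g(1) h(1)
        CompQ[OF g(1) h(1) VT Y VT] CompQ[OF h(1) g(1) Y VT Y] by simp
    then show "\<exists>T \<in> Ob (full_subcategory C \<T>). \<exists>e \<in> Hom Q.Q (V T) Y. is_iso Q.Q e"
      using T HomQ[OF VT Y] g(1) by auto
  qed
qed

end

theorem theorem1p8:
  fixes A :: "('o, 'm) preadditive_data" and \<T> \<F> \<D> :: "'o set"
  assumes "abelian_category A"
    and "is_full_subcategory A \<T>" and "is_full_subcategory A \<F>" and "is_full_subcategory A \<D>"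
    and "torsion_pair A \<T> \<F>"
    and "cotorsion_pair A \<F> \<D>"
  shows "equivalent_categories (full_subcategory A \<T>)
           (quotient_category (full_subcategory A \<D>) (\<F> \<inter> \<D>))"
proof -
  interpret abelian_category A by fact
  interpret torsion_cotorsion_triple A \<T> \<F> \<D> by unfold_locales fact+
  show ?thesis by (rule equivalent_categories_torsion_quotient)
qed

end
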